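(* Fix positive integers $d$ and $p$. There is an algorithm that, given a matroid $M$ on the ground set $N=\{1,\dots,n\}$ presented by an independence oracle, integers $a_1,\dots,a_p\in\mathbb{Z}$, weight vectors $w_1,\dots,w_d\in\{a_1,\dots,a_p\}^n$, and a function $f:\mathbb{R}^d\to\mathbb{R}$ presented by a comparison oracle, solves the nonlinear matroid optimization problem (finds a base $B$ of $M$ minimizing $f(W(B))$) in time polynomial in $n$ and $\max_i\langle a_i\rangle$.
   Context: Nonlinear matroid optimization problem: given a matroid $M$ on $N=\{1,\dots,n\}$, integer weight vectors $w_i=(w_{i,1},\dots,w_{i,n})\in\mathbb{Z}^n$ for $i=1,\dots,d$ and a function $f:\mathbb{R}^d\to\mathbb{R}$, find a base $B$ of $M$ minimizing $f(W(B))$, where for $S\subseteq N$ the $W$-profile is $W(S):=(w_1(S),\dots,w_d(S))$ with $w_i(S)=\sum_{j\in S}w_{i,j}$. An independence oracle, queried on $I\subseteq N$, answers whether $I$ is independent in $M$. A comparison oracle for $f$, queried on $x,y\in\mathbb{Z}^d$, answers whether $f(x)\le f(y)$. Running time counts oracle queries. $\langle z\rangle$ denotes the binary length of an integer $z$, $\langle z\rangle=1+\lceil\log_2(|z|+1)\rceil$. *)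

theory Defs
  imports Complex_Main "HOL-Computational_Algebra.Polynomial"
begin

section \<open>Matroids and the nonlinear matroid optimization problem\<close>

locale matroid =
  fixes N :: "'a set" and indep :: "'a set \<Rightarrow> bool"
  assumes finite_ground: "finite N"
    and indep_subset_ground: "indep I \<Longrightarrow> I \<subseteq> N"
    and indep_empty: "indep {}"
    and indep_mono: "indep J \<Longrightarrow> I \<subseteq> J \<Longrightarrow> indep I"
    and indep_augment: "indep I \<Longrightarrow> indep J \<Longrightarrow> card I < card J \<Longrightarrow>
          \<exists>x\<in>J - I. indep (insert x I)"

definition is_base :: "('a set \<Rightarrow> bool) \<Rightarrow> 'a set \<Rightarrow> bool" where
  "is_base indep B \<longleftrightarrow> indep B \<and> (\<forall>I. indep I \<longrightarrow> B \<subseteq> I \<longrightarrow> I = B)"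

text \<open>Elements of \<open>\<int>\<^sup>d\<close> and \<open>\<real>\<^sup>d\<close> are lists of length \<open>d\<close>; accordingly a function on
  \<open>\<real>\<^sup>d\<close> is a function on real lists whose values at lists of other lengths are irrelevant.\<close>

definition profile :: "nat \<Rightarrow> (nat \<Rightarrow> nat \<Rightarrow> int) \<Rightarrow> nat set \<Rightarrow> int list" where
  "profile d w S = map (\<lambda>i. \<Sum>j\<in>S. w i j) [1..<Suc d]"

definition at_int :: "(real list \<Rightarrow> real) \<Rightarrow> int list \<Rightarrow> real" where
  "at_int f x = f (map real_of_int x)"

definition optimal_base ::
  "(nat set \<Rightarrow> bool) \<Rightarrow> nat \<Rightarrow> (nat \<Rightarrow> nat \<Rightarrow> int) \<Rightarrow> (real list \<Rightarrow> real) \<Rightarrow> nat set \<Rightarrow> bool" where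
  "optimal_base indep d w f B \<longleftrightarrow> is_base indep B \<and>
     (\<forall>B'. is_base indep B' \<longrightarrow> at_int f (profile d w B) \<le> at_int f (profile d w B'))"

definition bin_length :: "int \<Rightarrow> nat" where
  "bin_length z = nat (1 + \<lceil>log 2 (real_of_int (\<bar>z\<bar> + 1))\<rceil>)"


section \<open>Oracle random access machines with logarithmic cost\<close>

text \<open>Algorithms are finite programs of a random access machine with integer registers and
  finitely many integer memories with indirect addressing, in structured form. The only
  arithmetic is addition and subtraction, and every step is charged the binary lengths of all
  the numbers involved (operands, addresses, contents), so running times agree with those of
  oracle Turing machines up to a polynomial.

  The program never sees the matroid or the function \<open>f\<close> except through the two query
  instructions. A query is charged one unit plus the length of the query string: the
  independence oracle reads cells \<open>1,\<dots>,n\<close> of a memory as the indicator vector of a subset of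
  \<open>{1,\<dots>,n}\<close>, the comparison oracle reads cells \<open>1,\<dots>,d\<close> of two memories as two vectors
  of \<open>\<int>\<^sup>d\<close>.\<close>

datatype com =
    Skip
  | Const nat int            \<comment> \<open>\<open>Const r c\<close>: register \<open>r := c\<close>\<close>
  | Add nat nat nat          \<comment> \<open>\<open>Add r u v\<close>: \<open>r := u + v\<close>\<close>
  | Sub nat nat nat          \<comment> \<open>\<open>Sub r u v\<close>: \<open>r := u - v\<close>\<close>
  | Load nat nat nat         \<comment> \<open>\<open>Load r k u\<close>: \<open>r := \<close> cell \<open>u\<close> of memory \<open>k\<close>\<close>
  | Store nat nat nat        \<comment> \<open>\<open>Store k u v\<close>: cell \<open>u\<close> of memory \<open>k := v\<close>\<close>
  | Query_Indep nat nat      \<comment> \<open>\<open>Query_Indep r k\<close>: \<open>r := 1\<close> if the set stored in memory \<open>k\<close>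
                                  is independent, else \<open>0\<close>\<close>
  | Query_Le nat nat nat     \<comment> \<open>\<open>Query_Le r k l\<close>: \<open>r := 1\<close> if \<open>f x \<le> f y\<close> for the vectors
                                  \<open>x\<close>, \<open>y\<close> stored in memories \<open>k\<close>, \<open>l\<close>, else \<open>0\<close>\<close>
  | Seq com com
  | If nat com com           \<comment> \<open>the test of \<open>If\<close> and \<open>While\<close> is that the register is positive\<close>
  | While nat com

type_synonym regs = "nat \<Rightarrow> int"
type_synonym mems = "nat \<Rightarrow> int \<Rightarrow> int"
type_synonym state = "regs \<times> mems"

definition set_of_cells :: "nat \<Rightarrow> (int \<Rightarrow> int) \<Rightarrow> nat set" where
  "set_of_cells n A = {j \<in> {1..n}. A (int j) \<noteq> 0}"

definition vec_of_cells :: "nat \<Rightarrow> (int \<Rightarrow> int) \<Rightarrow> int list" where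
  "vec_of_cells d A = map (\<lambda>i. A (int i)) [1..<Suc d]"

definition cells_length :: "nat \<Rightarrow> (int \<Rightarrow> int) \<Rightarrow> nat" where
  "cells_length k A = (\<Sum>i=1..k. bin_length (A (int i)))"

text \<open>\<open>exec n d indep f c s t s'\<close>: started in state \<open>s\<close>, the program \<open>c\<close> halts in state \<open>s'\<close>
  after running time exactly \<open>t\<close>, where \<open>indep\<close> and \<open>f\<close> answer the queries. A program that
  does not halt from \<open>s\<close> has no such \<open>t\<close> and \<open>s'\<close>.\<close>

inductive exec ::
  "nat \<Rightarrow> nat \<Rightarrow> (nat set \<Rightarrow> bool) \<Rightarrow> (real list \<Rightarrow> real) \<Rightarrow> com \<Rightarrow> state \<Rightarrow> nat \<Rightarrow> state \<Rightarrow> bool"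
  for n d :: nat and indep :: "nat set \<Rightarrow> bool" and f :: "real list \<Rightarrow> real"
where
  Skip: "exec n d indep f Skip s 1 s"
| Const: "exec n d indep f (Const r c) (R, M) (1 + bin_length c) (R(r := c), M)"
| Add: "exec n d indep f (Add r u v) (R, M) (1 + bin_length (R u) + bin_length (R v))
          (R(r := R u + R v), M)"
| Sub: "exec n d indep f (Sub r u v) (R, M) (1 + bin_length (R u) + bin_length (R v))
          (R(r := R u - R v), M)"
| Load: "exec n d indep f (Load r k u) (R, M) (1 + bin_length (R u) + bin_length (M k (R u)))
          (R(r := M k (R u)), M)"
| Store: "exec n d indep f (Store k u v) (R, M) (1 + bin_length (R u) + bin_length (R v))
          (R, M(k := (M k)(R u := R v)))"
| Query_Indep: "exec n d indep f (Query_Indep r k) (R, M) (1 + cells_length n (M k))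
          (R(r := if indep (set_of_cells n (M k)) then 1 else 0), M)"
| Query_Le: "exec n d indep f (Query_Le r k l) (R, M)
          (1 + cells_length d (M k) + cells_length d (M l))
          (R(r := if at_int f (vec_of_cells d (M k)) \<le> at_int f (vec_of_cells d (M l))
                  then 1 else 0), M)"
| Seq: "exec n d indep f c1 s t1 s' \<Longrightarrow> exec n d indep f c2 s' t2 s'' \<Longrightarrow>
          exec n d indep f (Seq c1 c2) s (t1 + t2) s''"
| If_True: "R r > 0 \<Longrightarrow> exec n d indep f c1 (R, M) t s' \<Longrightarrow>
          exec n d indep f (If r c1 c2) (R, M) (1 + bin_length (R r) + t) s'"
| If_False: "R r \<le> 0 \<Longrightarrow> exec n d indep f c2 (R, M) t s' \<Longrightarrow>
          exec n d indep f (If r c1 c2) (R, M) (1 + bin_length (R r) + t) s'"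
| While_False: "R r \<le> 0 \<Longrightarrow>
          exec n d indep f (While r c) (R, M) (1 + bin_length (R r)) (R, M)"
| While_True: "R r > 0 \<Longrightarrow> exec n d indep f c (R, M) t1 s' \<Longrightarrow>
          exec n d indep f (While r c) s' t2 s'' \<Longrightarrow>
          exec n d indep f (While r c) (R, M) (1 + bin_length (R r) + t1 + t2) s''"

inductive_cases exec_SkipE: "exec n d indep f Skip s t s'"
inductive_cases exec_ConstE: "exec n d indep f (Const r c) s t s'"
inductive_cases exec_AddE: "exec n d indep f (Add r u v) s t s'"
inductive_cases exec_SubE: "exec n d indep f (Sub r u v) s t s'"
inductive_cases exec_LoadE: "exec n d indep f (Load r k u) s t s'"
inductive_cases exec_StoreE: "exec n d indep f (Store k u v) s t s'"
inductive_cases exec_Query_IndepE: "exec n d indep f (Query_Indep r k) s t s'"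
inductive_cases exec_Query_LeE: "exec n d indep f (Query_Le r k l) s t s'"
inductive_cases exec_SeqE: "exec n d indep f (Seq c1 c2) s t s'"
inductive_cases exec_IfE: "exec n d indep f (If r c1 c2) s t s'"
inductive_cases exec_WhileE: "exec n d indep f (While r c) s t s'"

text \<open>The machine is deterministic, so the output and the running time of a halting
  computation are unique.\<close>

lemma exec_deterministic:
  "exec n d indep f c s t s' \<Longrightarrow> exec n d indep f c s u s'' \<Longrightarrow> u = t \<and> s'' = s'"
proof (induction arbitrary: u s'' rule: exec.induct)
  case (Seq c1 s t1 s' c2 t2 s2)
  from Seq.prems show ?case
  proof (rule exec_SeqE)
    fix u1 s1 u2
    assume u: "u = u1 + u2" and first: "exec n d indep f c1 s u1 s1"
      and second: "exec n d indep f c2 s1 u2 s''"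
    from Seq.IH(1)[OF first] have u1: "u1 = t1" "s1 = s'" by simp_all
    from second u1 have "exec n d indep f c2 s' u2 s''" by simp
    from Seq.IH(2)[OF this] have "u2 = t2" "s'' = s2" by simp_all
    with u1 u show ?thesis by simp
  qed
next
  case (If_True R r c1 M t s' c2)
  from If_True.prems show ?case
    by (rule exec_IfE) (use If_True.hyps in \<open>auto dest: If_True.IH\<close>)
next
  case (If_False R r c2 M t s' c1)
  from If_False.prems show ?case
    by (rule exec_IfE) (use If_False.hyps in \<open>auto dest: If_False.IH\<close>)
next
  case (While_False R r c M)
  from While_False.prems show ?case
    by (rule exec_WhileE) (use While_False.hyps in auto)
next
  case (While_True R r c M t1 s' t2 s2)
  from While_True.prems show ?case
  proof (rule exec_WhileE)
    fix R' M' v1 s1 v2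
    assume eq: "(R, M) = (R', M')" and u: "u = Suc (bin_length (R' r) + v1 + v2)"
      and body: "exec n d indep f c (R', M') v1 s1"
      and rest: "exec n d indep f (While r c) s1 v2 s''"
    from body eq have "exec n d indep f c (R, M) v1 s1" by simp
    from While_True.IH(1)[OF this] have v1: "v1 = t1" "s1 = s'" by simp_all
    from rest v1 have "exec n d indep f (While r c) s' v2 s''" by simp
    from While_True.IH(2)[OF this] have "v2 = t2" "s'' = s2" by simp_all
    with v1 eq u show ?thesis by simp
  qed (use While_True.hyps in simp)
qed (erule exec_SkipE exec_ConstE exec_AddE exec_SubE exec_LoadE exec_StoreE
       exec_Query_IndepE exec_Query_LeE; simp)+

text \<open>Initially register \<open>0\<close> holds \<open>n\<close>, cells \<open>1,\<dots>,p\<close> of memory \<open>0\<close> hold \<open>a\<^sub>1,\<dots>,a\<^sub>p\<close>, cells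
  \<open>1,\<dots>,n\<close> of memory \<open>i\<close> hold the weight vector \<open>w\<^sub>i\<close> (\<open>i = 1,\<dots>,d\<close>), and everything else
  is \<open>0\<close>. The output is the set with indicator vector in cells \<open>1,\<dots>,n\<close> of memory \<open>d + 1\<close>.\<close>

definition input_state :: "nat \<Rightarrow> nat \<Rightarrow> nat \<Rightarrow> (nat \<Rightarrow> int) \<Rightarrow> (nat \<Rightarrow> nat \<Rightarrow> int) \<Rightarrow> state" where
  "input_state d p n a w =
     ((\<lambda>r. if r = 0 then int n else 0),
      (\<lambda>k x. if k = 0 \<and> 1 \<le> x \<and> x \<le> int p then a (nat x)
             else if 1 \<le> k \<and> k \<le> d \<and> 1 \<le> x \<and> x \<le> int n then w k (nat x)
             else 0))"

definition output_set :: "nat \<Rightarrow> nat \<Rightarrow> state \<Rightarrow> nat set" where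
  "output_set d n s = set_of_cells n (snd s (Suc d))"

text \<open>Evaluation of a polynomial in two variables with natural number coefficients: the
  coefficients of \<open>q\<close> are polynomials in \<open>x\<close>, the outer indeterminate is \<open>y\<close>.\<close>

definition poly2 :: "nat poly poly \<Rightarrow> nat \<Rightarrow> nat \<Rightarrow> nat" where
  "poly2 q x y = poly (poly q [:y:]) x"

end

theory Submission
  imports Defs
begin

text \<open>Colour each element of the ground set by its vector of weights; there are at most
  \<open>p\<^sup>d\<close> colours, and the profile of a set depends only on the number of its elements of each
  colour. So it suffices to try each of the polynomially many vectors \<open>l\<close> of
  quotas in \<open>{0,\<dots>,n}\<close> and to find, where possible, an independent set with exactly \<open>l k\<close> elements of each colour
  \<open>k\<close>. By a variant of Rado's theorem, one exists if and only if, for every set \<open>A\<close> of colours, the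
  elements with colour in \<open>A\<close> have rank at least the sum of the quotas over \<open>A\<close>. Each of these
  constantly many conditions is decided by the greedy algorithm, and deleting elements one by one
  as long as the conditions survive leaves exactly such a set.\<close>

section \<open>Rado's theorem with quotas\<close>

text \<open>Prescribing the colour counts of an independent set is a matroid intersection problem
  whose second matroid is a partition matroid. With constantly many colours its rank conditions can
  be checked outright, which avoids augmenting paths and leaves a program short enough to be
  verified instruction by instruction. The search is not told the size of a base. Quota vectors with
  any sum are tried, and independent candidates are ranked by size first and by \<open>f\<close>
  second, so that a best candidate is automatically a base. As \<open>f\<close> can only be
  compared, never evaluated, the best set is kept together with its size and profile, starting from
  the empty set. Colours are numbered by tuples of indices into the values \<open>a\<close>, not by
  tuples of values. Their number is therefore \<open>p ^ d\<close>, a constant of the program,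
  whatever coincidences occur among the values.\<close>

context matroid
begin

section \<open>Matroid rank and its submodularity\<close>

lemma indep_finite: "indep I \<Longrightarrow> finite I"
  using finite_ground indep_subset_ground finite_subset by blast

definition rank :: "'a set \<Rightarrow> nat" where
  "rank X = Max (card ` {I. indep I \<and> I \<subseteq> X})"

lemma finite_indep_cards: "finite (card ` {I. indep I \<and> I \<subseteq> X})"
proof -
  have "{I. indep I \<and> I \<subseteq> X} \<subseteq> Pow N" using indep_subset_ground by auto
  then show ?thesis using finite_ground by (meson finite_Pow_iff finite_imageI finite_subset)
qed

lemma card_le_rank: "indep I \<Longrightarrow> I \<subseteq> X \<Longrightarrow> card I \<le> rank X"
  unfolding rank_def by (rule Max_ge[OF finite_indep_cards]) auto

lemma rank_attained: obtains I where "indep I" "I \<subseteq> X" "card I = rank X"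
proof -
  have "rank X \<in> card ` {I. indep I \<and> I \<subseteq> X}"
    unfolding rank_def by (rule Max_in[OF finite_indep_cards]) (use indep_empty in auto)
  then show thesis using that by auto
qed

lemma rank_leI: "(\<And>I. indep I \<Longrightarrow> I \<subseteq> X \<Longrightarrow> card I \<le> m) \<Longrightarrow> rank X \<le> m"
  by (metis rank_attained)

lemma rank_mono: "X \<subseteq> Y \<Longrightarrow> rank X \<le> rank Y"
  by (rule rank_leI) (auto intro: card_le_rank)

lemma rank_le_card: "finite X \<Longrightarrow> rank X \<le> card X"
  by (rule rank_leI) (auto intro: card_mono)

text \<open>Were \<open>I\<close> smaller than a largest independent subset of \<open>X\<close>,
  augmentation would supply an element contradicting maximality. This is why a greedy sweep computes
  the rank.\<close>

lemma maximal_card_eq_rank: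
  assumes "indep I" "I \<subseteq> X" "\<And>x. x \<in> X - I \<Longrightarrow> \<not> indep (insert x I)"
  shows "card I = rank X"
proof (rule antisym)
  show "card I \<le> rank X" using assms card_le_rank by blast
  obtain J where J: "indep J" "J \<subseteq> X" "card J = rank X" by (rule rank_attained)
  show "rank X \<le> card I"
    using indep_augment[OF assms(1) J(1)] J assms(3) by (metis DiffD1 DiffD2 DiffI linorder_not_less subset_iff)
qed

lemma indep_extend:
  assumes "indep I" "I \<subseteq> X"
  obtains J where "indep J" "I \<subseteq> J" "J \<subseteq> X" "card J = rank X"
  using assms
proof (induction "rank X - card I" arbitrary: I thesis rule: less_induct)
  case less
  show ?case
  proof (cases "\<exists>x\<in>X - I. indep (insert x I)")
    case True
    then obtain x where x: "x \<in> X - I" "indep (insert x I)" by blast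
    have "card (insert x I) = Suc (card I)" using x indep_finite[OF less.prems(2)] by simp
    moreover have "card (insert x I) \<le> rank X" using x less.prems by (intro card_le_rank) auto
    ultimately have "rank X - card (insert x I) < rank X - card I" by simp
    from less.hyps[OF this _ x(2)] obtain J where
      "indep J" "insert x I \<subseteq> J" "J \<subseteq> X" "card J = rank X"
      using less.prems(3) x(1) by (metis DiffD1 insert_subset)
    then show ?thesis using less.prems(1) by blast
  next
    case False
    then show ?thesis using maximal_card_eq_rank[OF less.prems(2,3)] less.prems by blast
  qed
qed

text \<open>A basis \<open>I\<close> of the intersection is extended to a basis \<open>J\<close> of
  the union. Counting \<open>J\<close> inside \<open>X\<close> and inside \<open>Y\<close> counts
  the part in both sets twice, and this part contains \<open>I\<close>.\<close>

lemma rank_submodular: "rank (X \<union> Y) + rank (X \<inter> Y) \<le> rank X + rank Y"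
proof -
  obtain I where I: "indep I" "I \<subseteq> X \<inter> Y" "card I = rank (X \<inter> Y)" by (rule rank_attained)
  then obtain J where J: "indep J" "I \<subseteq> J" "J \<subseteq> X \<union> Y" "card J = rank (X \<union> Y)"
    using indep_extend[of I "X \<union> Y"] by blast
  have fin: "finite J" using J indep_finite by blast
  have "card J + card I \<le> card (J \<inter> X \<union> J \<inter> Y) + card (J \<inter> X \<inter> (J \<inter> Y))"
    by (intro add_mono card_mono) (use fin I J in auto)
  also have "\<dots> = card (J \<inter> X) + card (J \<inter> Y)"
    using fin by (subst card_Un_Int[symmetric]) auto
  also have "\<dots> \<le> rank X + rank Y"
    by (intro add_mono card_le_rank) (use J indep_mono in blast)+
  finally show ?thesis using I J by simp
qed

lemma is_base_iff_card_eq_rank: "is_base indep B \<longleftrightarrow> indep B \<and> card B = rank N"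
proof
  assume B: "is_base indep B"
  then have "card B = rank N" unfolding is_base_def
    by (intro maximal_card_eq_rank) (auto dest: indep_subset_ground)
  with B show "indep B \<and> card B = rank N" by (simp add: is_base_def)
next
  assume B: "indep B \<and> card B = rank N"
  have "I = B" if "indep I" "B \<subseteq> I" for I
    using that B card_le_rank[OF that(1) indep_subset_ground[OF that(1)]] indep_finite
    by (metis card_seteq)
  with B show "is_base indep B" by (simp add: is_base_def)
qed

text \<open>The Hall-Rado condition for the family in which colour class \<open>k\<close> occurs
  \<open>l k\<close> times. Quotas are integers because they are later read from memory
  cells.\<close>

definition quota_ok :: "'b set \<Rightarrow> ('a \<Rightarrow> 'b) \<Rightarrow> ('b \<Rightarrow> int) \<Rightarrow> 'a set \<Rightarrow> bool" where
  "quota_ok K c l S \<longleftrightarrow> (\<forall>A\<subseteq>K. (\<Sum>k\<in>A. l k) \<le> int (rank {x \<in> S. c x \<in> A}))"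

text \<open>Turned around: a deletion that violates the condition once does so for every smaller set
  too, so a single pass over the elements reaches a deletion-minimal set.\<close>

lemma quota_ok_mono: "quota_ok K c l S \<Longrightarrow> S \<subseteq> T \<Longrightarrow> quota_ok K c l T"
  unfolding quota_ok_def
  by (smt (verit, best) Collect_mono_iff of_nat_mono order_trans rank_mono subsetD)

text \<open>A sharpening of Rado's theorem. In a deletion-minimal set \<open>S\<close>, every element of colour \<open>k\<close>
  is a coloop of the restriction to the smallest tight colour set containing \<open>k\<close>.\<close>

lemma quota_minimal_card_le:
  assumes fin: "finite K" "finite S" and nonneg: "l k \<ge> 0"
    and ok: "quota_ok K c l S" and minimal: "\<And>x. x \<in> S \<Longrightarrow> \<not> quota_ok K c l (S - {x})"
  shows "int (card {x \<in> S. c x = k}) \<le> l k"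
proof (cases "{x \<in> S. c x = k} = {}")
  case True
  then show ?thesis using nonneg by (metis card.empty of_nat_0)
next
  case False
  define P where "P A = {x \<in> S. c x \<in> A}" for A
  define tight where "tight A \<longleftrightarrow> A \<subseteq> K \<and> k \<in> A \<and> int (rank (P A)) = sum l A" for A
  have ok': "sum l A \<le> int (rank (P A))" if "A \<subseteq> K" for A
    using ok that by (simp add: quota_ok_def P_def)
  \<comment> \<open>Deleting \<open>x\<close> breaks the condition for some \<open>A\<close>. This
    \<open>A\<close> contains \<open>k\<close>, as otherwise \<open>P A\<close> would not change;
    and since one deletion lowers the rank by at most one, \<open>A\<close> was tight.\<close>
  have tight_coloop: "\<exists>A. tight A \<and> rank (P A - {x}) < rank (P A)" if x: "x \<in> S" "c x = k" for x
  proof -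
    obtain A where A: "A \<subseteq> K" "\<not> sum l A \<le> int (rank {y \<in> S - {x}. c y \<in> A})"
      using minimal[OF x(1)] unfolding quota_ok_def by blast
    have eq: "{y \<in> S - {x}. c y \<in> A} = P A - {x}" by (auto simp: P_def)
    have "k \<in> A"
    proof (rule ccontr)
      assume "k \<notin> A"
      then have "P A - {x} = P A" using x by (auto simp: P_def)
      then show False using A eq ok'[OF A(1)] by simp
    qed
    moreover have "rank (P A) \<le> Suc (rank (P A - {x}))"
    proof -
      have "rank (P A) \<le> rank ((P A - {x}) \<union> {x})" by (rule rank_mono) auto
      also have "\<dots> \<le> rank (P A - {x}) + rank {x}"
        using rank_submodular[of "P A - {x}" "{x}"] by simp
      also have "\<dots> \<le> Suc (rank (P A - {x}))" using rank_le_card[of "{x}"] by simp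
      finally show ?thesis .
    qed
    ultimately show ?thesis using A eq ok'[OF A(1)] by (intro exI[of _ A]) (auto simp: tight_def)
  qed
  from False tight_coloop have "\<exists>A. tight A" by blast
  \<comment> \<open>A tight set of least cardinality; uncrossing shows below that it is contained in
    every tight set.\<close>
  then obtain A where A: "tight A" and least: "\<And>B. tight B \<Longrightarrow> card A \<le> card B"
    using exists_least_iff[of "\<lambda>m. \<exists>A. tight A \<and> card A = m"] by (metis not_le_imp_less)
  have finA: "finite A" using A fin finite_subset unfolding tight_def by blast
  have coloop: "rank (P A - {x}) < rank (P A)" if x: "x \<in> S" "c x = k" for x
  proof -
    obtain B where B: "tight B" "rank (P B - {x}) < rank (P B)" using tight_coloop[OF x] by blast
    have finB: "finite B" using B fin finite_subset unfolding tight_def by blast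
    have un: "P (A \<union> B) = P A \<union> P B" and int: "P (A \<inter> B) = P A \<inter> P B" by (auto simp: P_def)
    \<comment> \<open>Uncrossing: quota sums are modular, the rank is submodular, and the condition
      holds for both \<open>A \<union> B\<close> and \<open>A \<inter> B\<close>, so tightness of
      \<open>A\<close> and \<open>B\<close> forces equality throughout.\<close>
    have "sum l (A \<union> B) + sum l (A \<inter> B) = sum l A + sum l B"
      using finA finB by (simp add: sum.union_inter)
    moreover have "A \<union> B \<subseteq> K" "A \<inter> B \<subseteq> K" using A B by (auto simp: tight_def)
    note ok'[OF this(1)] ok'[OF this(2)]
    moreover have "int (rank (P (A \<union> B))) + int (rank (P (A \<inter> B))) \<le> int (rank (P A)) + int (rank (P B))"
      using rank_submodular[of "P A" "P B"] unfolding un int by linarith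
    ultimately have "tight (A \<inter> B)" using A B unfolding tight_def by auto
    then have "A \<inter> B = A" using least finA by (metis card_seteq inf_le1)
    then have sub: "P A \<subseteq> P B" by (auto simp: P_def)
    have "x \<in> P A" using x A by (auto simp: P_def tight_def)
    \<comment> \<open>Submodularity for \<open>P B - {x}\<close> and \<open>P A\<close> passes the
      loss of rank from the larger set \<open>P B\<close> down to \<open>P A\<close>.\<close>
    then have "(P B - {x}) \<union> P A = P B" "(P B - {x}) \<inter> P A = P A - {x}" using sub by auto
    then show ?thesis using rank_submodular[of "P B - {x}" "P A"] B by simp
  qed
  obtain I where I: "indep I" "I \<subseteq> P (A - {k})" "card I = rank (P (A - {k}))" by (rule rank_attained)
  have "P (A - {k}) \<subseteq> P A" by (auto simp: P_def)
  then obtain J where J: "indep J" "I \<subseteq> J" "J \<subseteq> P A" "card J = rank (P A)"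
    using indep_extend[OF I(1), of "P A"] I(2) by blast
  \<comment> \<open>A basis of \<open>P A\<close> avoiding \<open>x\<close> would survive the
    deletion of \<open>x\<close>. So \<open>J\<close> contains all elements of colour
    \<open>k\<close>, besides a basis of the elements with the other colours in
    \<open>A\<close>.\<close>
  have "x \<in> J" if x: "x \<in> S" "c x = k" for x
  proof (rule ccontr)
    assume "x \<notin> J"
    then have "card J \<le> rank (P A - {x})" using J by (intro card_le_rank) auto
    then show False using coloop[OF x] J by simp
  qed
  then have sub: "I \<union> {x \<in> S. c x = k} \<subseteq> J" using J by auto
  have "card I + card {x \<in> S. c x = k} = card (I \<union> {x \<in> S. c x = k})"
    by (rule card_Un_disjoint[symmetric]) (use I fin in \<open>auto simp: P_def intro: indep_finite\<close>)
  also have "\<dots> \<le> card J" by (rule card_mono[OF indep_finite[OF J(1)] sub])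
  finally have le: "rank (P (A - {k})) + card {x \<in> S. c x = k} \<le> rank (P A)" using I J by simp
  have "sum l (A - {k}) \<le> int (rank (P (A - {k})))" using A by (intro ok') (auto simp: tight_def)
  moreover have "sum l A = sum l (A - {k}) + l k"
    using A finA by (simp add: tight_def sum_diff1)
  ultimately show ?thesis using le A unfolding tight_def by linarith
qed

text \<open>The condition for the singleton \<open>{k}\<close> turns the preceding bound into an
  equality. The size of \<open>S\<close> is then the quota sum, and the condition for all of
  \<open>K\<close> forces the rank of \<open>S\<close> up to its size.\<close>

lemma quota_minimal:
  assumes fin: "finite K" "finite S" and col: "c ` S \<subseteq> K" and nonneg: "\<And>k. k \<in> K \<Longrightarrow> l k \<ge> 0"
    and ok: "quota_ok K c l S" and minimal: "\<And>x. x \<in> S \<Longrightarrow> \<not> quota_ok K c l (S - {x})"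
  shows "indep S" and "\<And>k. k \<in> K \<Longrightarrow> int (card {x \<in> S. c x = k}) = l k"
proof -
  show eq: "int (card {x \<in> S. c x = k}) = l k" if "k \<in> K" for k
  proof (rule antisym)
    show "int (card {x \<in> S. c x = k}) \<le> l k"
      by (rule quota_minimal_card_le) (use assms that in auto)
    have "l k \<le> int (rank {x \<in> S. c x \<in> {k}})"
      using ok[unfolded quota_ok_def, rule_format, of "{k}"] that by simp
    also have "\<dots> \<le> int (card {x \<in> S. c x = k})" using rank_le_card[of "{x \<in> S. c x = k}"] fin by simp
    finally show "l k \<le> int (card {x \<in> S. c x = k})" .
  qed
  have "card S = (\<Sum>k\<in>K. card {x \<in> S. c x = k})"
    using sum.group[OF fin(2,1) col, of "\<lambda>_. 1 :: nat"] by simp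
  then have "int (card S) = sum l K" using eq by simp
  also have "\<dots> \<le> int (rank {x \<in> S. c x \<in> K})" using ok unfolding quota_ok_def by blast
  also have "{x \<in> S. c x \<in> K} = S" using col by auto
  finally have le: "card S \<le> rank S" by simp
  obtain I where "indep I" "I \<subseteq> S" "card I = rank S" by (rule rank_attained)
  then show "indep S" using le fin by (metis card_seteq)
qed

text \<open>The easy half of Rado's theorem: the part of \<open>B\<close> with colours in
  \<open>A\<close> is independent, and its size is the quota sum over \<open>A\<close>.\<close>

lemma quota_ok_of_indep:
  assumes "finite K" "indep B" "B \<subseteq> S" "\<And>k. k \<in> K \<Longrightarrow> l k = int (card {x \<in> B. c x = k})"
  shows "quota_ok K c l S"
  unfolding quota_ok_def
proof (intro allI impI)
  fix A assume A: "A \<subseteq> K"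
  have finA: "finite A" using A assms(1) finite_subset by blast
  have finB: "finite B" using assms indep_finite by blast
  have "sum l A = (\<Sum>k\<in>A. int (card {x \<in> {x \<in> B. c x \<in> A}. c x = k}))"
    using A assms(4) by (intro sum.cong) (auto intro!: arg_cong[of _ _ card])
  also have "\<dots> = int (card {x \<in> B. c x \<in> A})"
    using sum.group[of "{x \<in> B. c x \<in> A}" A c "\<lambda>_. 1 :: int"] finA finB by force
  also have "\<dots> \<le> int (rank {x \<in> S. c x \<in> A})"
    unfolding of_nat_le_iff by (rule card_le_rank) (use assms indep_mono[of B] in auto)
  finally show "sum l A \<le> int (rank {x \<in> S. c x \<in> A})" .
qed

end

section \<open>A unit cost calculus for the machine\<close>

text \<open>The registers that a program may write, read off from its text; \<open>wmem\<close> does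
  the same for memories. Loop invariants then need not mention what a body leaves alone.\<close>

fun wreg :: "com \<Rightarrow> nat set" where
  "wreg Skip = {}"
| "wreg (Const r c) = {r}"
| "wreg (Add r u v) = {r}"
| "wreg (Sub r u v) = {r}"
| "wreg (Load r k u) = {r}"
| "wreg (Store k u v) = {}"
| "wreg (Query_Indep r k) = {r}"
| "wreg (Query_Le r k l) = {r}"
| "wreg (Seq c1 c2) = wreg c1 \<union> wreg c2"
| "wreg (If r c1 c2) = wreg c1 \<union> wreg c2"
| "wreg (While r c) = wreg c"

fun wmem :: "com \<Rightarrow> nat set" where
  "wmem (Store k u v) = {k}"
| "wmem (Seq c1 c2) = wmem c1 \<union> wmem c2"
| "wmem (If r c1 c2) = wmem c1 \<union> wmem c2"
| "wmem (While r c) = wmem c"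
| "wmem _ = {}"

lemma exec_frame:
  "exec n d indep f c s t s' \<Longrightarrow>
    (\<forall>r. r \<notin> wreg c \<longrightarrow> fst s' r = fst s r) \<and> (\<forall>m. m \<notin> wmem c \<longrightarrow> snd s' m = snd s m)"
  by (induction rule: exec.induct) auto

definition bounded_state :: "nat \<Rightarrow> regs \<Rightarrow> mems \<Rightarrow> bool" where
  "bounded_state b R M \<longleftrightarrow> (\<forall>r. \<bar>R r\<bar> < 2 ^ b) \<and> (\<forall>m x. \<bar>M m x\<bar> < 2 ^ b)"

lemma bin_length_le: "\<bar>z\<bar> < 2 ^ b \<Longrightarrow> bin_length z \<le> Suc b"
proof -
  assume z: "\<bar>z\<bar> < 2 ^ b"
  then have "real_of_int (\<bar>z\<bar> + 1) \<le> 2 ^ b"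
    by (metis of_int_le_iff of_int_numeral of_int_power zless_imp_add1_zle)
  then have "log 2 (real_of_int (\<bar>z\<bar> + 1)) \<le> real b"
    by (subst log_le_iff) (auto simp: powr_realpow)
  then show ?thesis unfolding bin_length_def by linarith
qed

lemma abs_less_of_bin_length: "bin_length z \<le> b \<Longrightarrow> \<bar>z\<bar> < 2 ^ b"
proof -
  assume z: "bin_length z \<le> b"
  have "log 2 (real_of_int (\<bar>z\<bar> + 1)) \<le> real b" using z unfolding bin_length_def by linarith
  then have "real_of_int (\<bar>z\<bar> + 1) \<le> 2 ^ b"
    by (subst (asm) log_le_iff) (auto simp: powr_realpow)
  then have "real_of_int (\<bar>z\<bar> + 1) \<le> real_of_int (2 ^ b)" by simp
  then have "\<bar>z\<bar> + 1 \<le> 2 ^ b" unfolding of_int_le_iff .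
  then show ?thesis by linarith
qed

lemma bounded_state_mono: "bounded_state b R M \<Longrightarrow> b \<le> b' \<Longrightarrow> bounded_state b' R M"
  unfolding bounded_state_def by (meson less_le_trans one_le_numeral power_increasing)

text \<open>Register \<open>1\<close> is scratch throughout.\<close>

definition For :: "nat \<Rightarrow> nat \<Rightarrow> com \<Rightarrow> com" where
  "For r u body = Seq (Const 1 0) (Seq (Add r u 1)
     (While r (Seq body (Seq (Const 1 1) (Sub r r 1)))))"

lemma wreg_For [simp]: "wreg (For r u body) = insert 1 (insert r (wreg body))"
  and wmem_For [simp]: "wmem (For r u body) = wmem body"
  by (auto simp: For_def)

text \<open>Memory numbers and constants are part of the program text and cannot be computed at run
  time. Passes over the weight memories or over the table of tuples are therefore written out; their
  length depends on \<open>d\<close> and \<open>p\<close> only.\<close>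

primrec unroll :: "(nat \<Rightarrow> com) \<Rightarrow> nat \<Rightarrow> com" where
  "unroll c 0 = Skip"
| "unroll c (Suc m) = Seq (unroll c m) (c (Suc m))"

lemma wreg_unroll: "(\<And>i. wreg (c i) \<subseteq> X) \<Longrightarrow> wreg (unroll c m) \<subseteq> X"
  and wmem_unroll: "(\<And>i. wmem (c i) \<subseteq> X) \<Longrightarrow> wmem (unroll c m) \<subseteq> X"
  by (induction m) auto

text \<open>An odometer: one nested loop, with its own counter register, per digit. The nesting
  depth is a constant of the program and becomes the exponent in the running time.\<close>

primrec enum :: "nat \<Rightarrow> nat \<Rightarrow> nat \<Rightarrow> com \<Rightarrow> nat \<Rightarrow> com" where
  "enum base mem bnd body 0 = body"
| "enum base mem bnd body (Suc k) = For (base + k) bnd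
     (Seq (Const 1 1) (Seq (Sub 2 (base + k) 1) (Seq (Const 3 (int (Suc k))) (Seq (Store mem 3 2)
       (enum base mem bnd body k)))))"

lemma wreg_enum: "wreg (enum base mem bnd body k) \<subseteq> {1, 2, 3} \<union> {base..<base + k} \<union> wreg body"
  and wmem_enum: "wmem (enum base mem bnd body k) \<subseteq> insert mem (wmem body)"
  by (induction k) auto

text \<open>Each round adds four instructions that write the digit and three of loop control;
  entering and leaving the loop costs another three.\<close>

primrec enum_time :: "nat \<Rightarrow> nat \<Rightarrow> nat \<Rightarrow> nat" where
  "enum_time b t 0 = t"
| "enum_time b t (Suc k) = b * (enum_time b t k + 7) + 3"

text \<open>The parameter \<open>\<beta>\<close> bounds the constants in the program. Only bit
  lengths above \<open>\<beta>\<close> are considered later, so that loading a constant never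
  lengthens the numbers in the state.\<close>

locale machine =
  fixes n d :: nat and indep :: "nat set \<Rightarrow> bool" and f :: "real list \<Rightarrow> real" and \<beta> :: nat
begin

text \<open>Covers every instruction on numbers of absolute value below \<open>2 ^ b\<close>: an
  independence query reads \<open>n\<close> cells, a comparison \<open>2 * d\<close>, any other
  instruction at most two numbers, each of length at most \<open>b + 1\<close>.\<close>

definition step_cost :: "nat \<Rightarrow> nat" where
  "step_cost b = 1 + (n + 2 * d + 2) * (b + 1)"

lemma step_cost_mono: "b \<le> b' \<Longrightarrow> step_cost b \<le> step_cost b'"
  unfolding step_cost_def by (intro add_left_mono mult_left_mono add_right_mono) auto

text \<open>A step at most doubles the largest number in the state. Hence, if \<open>k\<close> counts steps at unit
  cost, the numbers involved have at most \<open>b + k\<close> bits and the logarithmic cost is bounded in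
  terms of \<open>k\<close> and the initial bit length \<open>b\<close> alone.\<close>

definition wp :: "com \<Rightarrow> nat \<Rightarrow> (regs \<Rightarrow> mems \<Rightarrow> bool) \<Rightarrow> regs \<Rightarrow> mems \<Rightarrow> bool" where
  "wp c k Q R M \<longleftrightarrow> (\<forall>b>\<beta>. bounded_state b R M \<longrightarrow>
     (\<exists>t R' M'. exec n d indep f c (R, M) t (R', M') \<and> t \<le> k * step_cost (b + k) \<and>
        bounded_state (b + k) R' M' \<and> Q R' M'))"

lemma wp_stepI:
  assumes "\<And>b. b > \<beta> \<Longrightarrow> bounded_state b R M \<Longrightarrow>
      \<exists>t. exec n d indep f c (R, M) t (R', M') \<and> t \<le> step_cost b \<and> bounded_state (Suc b) R' M'"
    and "Q R' M'"
  shows "wp c 1 Q R M"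
  unfolding wp_def
proof (intro allI impI)
  fix b assume b: "\<beta> < b" "bounded_state b R M"
  from assms(1)[OF b] obtain t where t: "exec n d indep f c (R, M) t (R', M')" "t \<le> step_cost b"
    "bounded_state (Suc b) R' M'" by blast
  have "t \<le> 1 * step_cost (b + 1)" using t(2) step_cost_mono[of b "b + 1"] by simp
  then show "\<exists>t R' M'. exec n d indep f c (R, M) t (R', M') \<and> t \<le> 1 * step_cost (b + 1) \<and>
      bounded_state (b + 1) R' M' \<and> Q R' M'"
    using t assms(2) by auto
qed

lemma bounded_state_reg:
  "bounded_state b R M \<Longrightarrow> \<bar>z\<bar> < 2 ^ Suc b \<Longrightarrow> bounded_state (Suc b) (R(r := z)) M"
  using bounded_state_mono[of b R M "Suc b"] by (auto simp: bounded_state_def)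

lemma bin_length_reg: "bounded_state b R M \<Longrightarrow> bin_length (R r) \<le> Suc b"
  and bin_length_cell: "bounded_state b R M \<Longrightarrow> bin_length (M m x) \<le> Suc b"
  by (auto simp: bounded_state_def intro: bin_length_le)

lemma cells_length_le:
  assumes "bounded_state b R M"
  shows "cells_length k (M m) \<le> k * Suc b"
proof -
  have "cells_length k (M m) \<le> of_nat (card {1..k}) * Suc b"
    unfolding cells_length_def by (rule sum_bounded_above) (rule bin_length_cell[OF assms])
  then show ?thesis by simp
qed

lemma two_lengths_le: "x \<le> Suc b \<Longrightarrow> y \<le> Suc b \<Longrightarrow> 1 + x + y \<le> step_cost b"
  by (simp add: step_cost_def algebra_simps)

section \<open>Rules for single instructions\<close>

lemma wp_Skip:
  assumes "Q R M"
  shows "wp Skip 1 Q R M"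
proof (rule wp_stepI[where Q = Q, OF _ assms])
  fix b assume b: "\<beta> < b" "bounded_state b R M"
  have "bounded_state (Suc b) R M" using b(2) by (rule bounded_state_mono) simp
  moreover have "1 \<le> step_cost b" by (simp add: step_cost_def)
  ultimately show "\<exists>t. exec n d indep f Skip (R, M) t (R, M) \<and> t \<le> step_cost b \<and>
      bounded_state (Suc b) R M"
    using exec.Skip by blast
qed

lemma wp_Const:
  assumes "0 \<le> c" "c \<le> int \<beta>" "Q (R(r := c)) M"
  shows "wp (Const r c) 1 Q R M"
proof (rule wp_stepI[where Q = Q, OF _ assms(3)])
  fix b assume b: "\<beta> < b" "bounded_state b R M"
  have "int \<beta> < 2 ^ b"
    using b(1) less_exp[of b] by (metis of_nat_less_iff of_nat_numeral of_nat_power order_less_trans)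
  then have "c < 2 ^ b" using assms(2) by linarith
  then have c: "\<bar>c\<bar> < 2 ^ b" using assms(1) by simp
  then have "1 + bin_length c \<le> step_cost b" using bin_length_le[OF c] by (simp add: step_cost_def)
  moreover have "bounded_state (Suc b) (R(r := c)) M"
    using b(2) c by (intro bounded_state_reg) auto
  ultimately show "\<exists>t. exec n d indep f (Const r c) (R, M) t (R(r := c), M) \<and> t \<le> step_cost b \<and>
      bounded_state (Suc b) (R(r := c)) M"
    using exec.Const by blast
qed

lemma wp_Add:
  assumes "Q (R(r := R u + R v)) M"
  shows "wp (Add r u v) 1 Q R M"
proof (rule wp_stepI[where Q = Q, OF _ assms])
  fix b assume b: "\<beta> < b" "bounded_state b R M"
  have "\<bar>R u\<bar> < 2 ^ b" "\<bar>R v\<bar> < 2 ^ b" using b by (auto simp: bounded_state_def)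
  then have "bounded_state (Suc b) (R(r := R u + R v)) M"
    using b(2) by (intro bounded_state_reg) auto
  moreover have "1 + bin_length (R u) + bin_length (R v) \<le> step_cost b"
    using b by (intro two_lengths_le bin_length_reg) auto
  ultimately show "\<exists>t. exec n d indep f (Add r u v) (R, M) t (R(r := R u + R v), M) \<and>
      t \<le> step_cost b \<and> bounded_state (Suc b) (R(r := R u + R v)) M"
    using exec.Add by blast
qed

lemma wp_Sub:
  assumes "Q (R(r := R u - R v)) M"
  shows "wp (Sub r u v) 1 Q R M"
proof (rule wp_stepI[where Q = Q, OF _ assms])
  fix b assume b: "\<beta> < b" "bounded_state b R M"
  have "\<bar>R u\<bar> < 2 ^ b" "\<bar>R v\<bar> < 2 ^ b" using b by (auto simp: bounded_state_def)
  then have "bounded_state (Suc b) (R(r := R u - R v)) M"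
    using b(2) by (intro bounded_state_reg) auto
  moreover have "1 + bin_length (R u) + bin_length (R v) \<le> step_cost b"
    using b by (intro two_lengths_le bin_length_reg) auto
  ultimately show "\<exists>t. exec n d indep f (Sub r u v) (R, M) t (R(r := R u - R v), M) \<and>
      t \<le> step_cost b \<and> bounded_state (Suc b) (R(r := R u - R v)) M"
    using exec.Sub by blast
qed

lemma wp_Load:
  assumes "Q (R(r := M k (R u))) M"
  shows "wp (Load r k u) 1 Q R M"
proof (rule wp_stepI[where Q = Q, OF _ assms])
  fix b assume b: "\<beta> < b" "bounded_state b R M"
  have "\<bar>M k (R u)\<bar> < 2 ^ b" using b by (auto simp: bounded_state_def)
  then have "bounded_state (Suc b) (R(r := M k (R u))) M"
    using b(2) by (intro bounded_state_reg) auto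
  moreover have "1 + bin_length (R u) + bin_length (M k (R u)) \<le> step_cost b"
    using b by (intro two_lengths_le bin_length_reg bin_length_cell) auto
  ultimately show "\<exists>t. exec n d indep f (Load r k u) (R, M) t (R(r := M k (R u)), M) \<and>
      t \<le> step_cost b \<and> bounded_state (Suc b) (R(r := M k (R u))) M"
    using exec.Load by blast
qed

lemma wp_Store:
  assumes "Q R (M(k := (M k)(R u := R v)))"
  shows "wp (Store k u v) 1 Q R M"
proof (rule wp_stepI[where Q = Q, OF _ assms])
  fix b assume b: "\<beta> < b" "bounded_state b R M"
  have "bounded_state b R (M(k := (M k)(R u := R v)))" using b by (auto simp: bounded_state_def)
  then have "bounded_state (Suc b) R (M(k := (M k)(R u := R v)))"
    by (rule bounded_state_mono) simp
  moreover have "1 + bin_length (R u) + bin_length (R v) \<le> step_cost b"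
    using b by (intro two_lengths_le bin_length_reg) auto
  ultimately show "\<exists>t. exec n d indep f (Store k u v) (R, M) t (R, M(k := (M k)(R u := R v))) \<and>
      t \<le> step_cost b \<and> bounded_state (Suc b) R (M(k := (M k)(R u := R v)))"
    using exec.Store by blast
qed

lemma wp_Query_Indep:
  assumes "Q (R(r := if indep (set_of_cells n (M k)) then 1 else 0)) M"
  shows "wp (Query_Indep r k) 1 Q R M"
proof (rule wp_stepI[where Q = Q, OF _ assms])
  fix b assume b: "\<beta> < b" "bounded_state b R M"
  have "bounded_state (Suc b) (R(r := if indep (set_of_cells n (M k)) then 1 else 0)) M"
    using b(2) one_less_power[of "2 :: int" "Suc b"] by (intro bounded_state_reg) auto
  moreover have "1 + cells_length n (M k) \<le> step_cost b"
    using cells_length_le[OF b(2), of n k] by (simp add: step_cost_def algebra_simps)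
  ultimately show "\<exists>t. exec n d indep f (Query_Indep r k) (R, M) t
        (R(r := if indep (set_of_cells n (M k)) then 1 else 0), M) \<and>
      t \<le> step_cost b \<and> bounded_state (Suc b) (R(r := if indep (set_of_cells n (M k)) then 1 else 0)) M"
    using exec.Query_Indep by blast
qed

lemma wp_Query_Le:
  assumes "Q (R(r := if at_int f (vec_of_cells d (M k)) \<le> at_int f (vec_of_cells d (M l))
                  then 1 else 0)) M"
  shows "wp (Query_Le r k l) 1 Q R M"
proof (rule wp_stepI[where Q = Q, OF _ assms])
  fix b assume b: "\<beta> < b" "bounded_state b R M"
  let ?R = "R(r := if at_int f (vec_of_cells d (M k)) \<le> at_int f (vec_of_cells d (M l)) then 1 else 0)"
  have "bounded_state (Suc b) ?R M"
    using b(2) one_less_power[of "2 :: int" "Suc b"] by (intro bounded_state_reg) auto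
  moreover have "1 + cells_length d (M k) + cells_length d (M l) \<le> step_cost b"
    using cells_length_le[OF b(2), of d k] cells_length_le[OF b(2), of d l]
    by (simp add: step_cost_def algebra_simps)
  ultimately show "\<exists>t. exec n d indep f (Query_Le r k l) (R, M) t (?R, M) \<and>
      t \<le> step_cost b \<and> bounded_state (Suc b) ?R M"
    using exec.Query_Le by blast
qed

section \<open>Rules for composition, branching and loops\<close>

lemma wpE:
  assumes "wp c k Q R M" "\<beta> < b" "bounded_state b R M"
  obtains t R' M' where "exec n d indep f c (R, M) t (R', M')" "t \<le> k * step_cost (b + k)"
    "bounded_state (b + k) R' M'" "Q R' M'"
  using assms unfolding wp_def by blast

text \<open>Besides weakening the postcondition, this rule hands over everything that the program
  cannot write as unchanged. It is the only channel by which frame facts enter later proofs about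
  subprograms.\<close>

lemma wp_mono:
  assumes wp: "wp c k Q R M" and le: "k \<le> k'"
    and Q: "\<And>R' M'. Q R' M' \<Longrightarrow> (\<And>r. r \<notin> wreg c \<Longrightarrow> R' r = R r) \<Longrightarrow>
      (\<And>m. m \<notin> wmem c \<Longrightarrow> M' m = M m) \<Longrightarrow> Q' R' M'"
  shows "wp c k' Q' R M"
  unfolding wp_def
proof (intro allI impI)
  fix b assume b: "\<beta> < b" "bounded_state b R M"
  obtain t R' M' where ex: "exec n d indep f c (R, M) t (R', M')" and t: "t \<le> k * step_cost (b + k)"
    and bd: "bounded_state (b + k) R' M'" and post: "Q R' M'"
    using wpE[OF wp b] by blast
  have "t \<le> k' * step_cost (b + k')"
    using t le step_cost_mono[of "b + k" "b + k'"] by (meson add_left_mono mult_le_mono order_trans)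
  moreover have "bounded_state (b + k') R' M'" using bd le by (auto intro: bounded_state_mono)
  moreover have "Q' R' M'" using Q[OF post] exec_frame[OF ex] by simp
  ultimately show "\<exists>t R' M'. exec n d indep f c (R, M) t (R', M') \<and> t \<le> k' * step_cost (b + k') \<and>
      bounded_state (b + k') R' M' \<and> Q' R' M'"
    using ex by blast
qed

lemma wp_le: "wp c k Q R M \<Longrightarrow> k \<le> k' \<Longrightarrow> wp c k' Q R M"
  by (erule wp_mono)

text \<open>The second program may meet numbers of \<open>b + k1\<close> bits; charging both parts
  at the final length \<open>b + (k1 + k2)\<close> makes the bounds additive.\<close>

lemma wp_Seq:
  assumes "wp c1 k1 (wp c2 k2 Q) R M"
  shows "wp (Seq c1 c2) (k1 + k2) Q R M"
  unfolding wp_def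
proof (intro allI impI)
  fix b assume b: "\<beta> < b" "bounded_state b R M"
  obtain t1 R1 M1 where 1: "exec n d indep f c1 (R, M) t1 (R1, M1)" "t1 \<le> k1 * step_cost (b + k1)"
    "bounded_state (b + k1) R1 M1" "wp c2 k2 Q R1 M1"
    using wpE[OF assms b] by blast
  have "\<beta> < b + k1" using b by simp
  then obtain t2 R2 M2 where 2: "exec n d indep f c2 (R1, M1) t2 (R2, M2)"
    "t2 \<le> k2 * step_cost (b + k1 + k2)" "bounded_state (b + k1 + k2) R2 M2" "Q R2 M2"
    using wpE[OF 1(4) _ 1(3)] by blast
  have "t1 \<le> k1 * step_cost (b + (k1 + k2))"
    using 1(2) step_cost_mono[of "b + k1" "b + (k1 + k2)"] by (meson le_add1 add_left_mono mult_le_mono2 order_trans)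
  then have "t1 + t2 \<le> (k1 + k2) * step_cost (b + (k1 + k2))"
    using 2(2) by (simp add: add_mult_distrib add.assoc)
  then show "\<exists>t R' M'. exec n d indep f (Seq c1 c2) (R, M) t (R', M') \<and>
      t \<le> (k1 + k2) * step_cost (b + (k1 + k2)) \<and> bounded_state (b + (k1 + k2)) R' M' \<and> Q R' M'"
    using exec.Seq[OF 1(1) 2(1)] 2 by (metis add.assoc)
qed

lemma test_cost_le:
  assumes "bounded_state b R M" "t \<le> k * step_cost (b + k)"
  shows "1 + bin_length (R r) + t \<le> (1 + k) * step_cost (b + (1 + k))"
proof -
  have "1 + bin_length (R r) \<le> step_cost (b + (1 + k))"
    using bin_length_reg[OF assms(1), of r] by (simp add: step_cost_def)
  moreover have "t \<le> k * step_cost (b + (1 + k))"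
    using assms(2) step_cost_mono[of "b + k" "b + (1 + k)"]
    by (meson add_left_mono le_add2 mult_le_mono2 order_trans)
  ultimately show ?thesis by (simp add: add_mult_distrib)
qed

lemma wp_If:
  assumes "R r > 0 \<Longrightarrow> wp c1 k1 Q R M" "R r \<le> 0 \<Longrightarrow> wp c2 k2 Q R M"
  shows "wp (If r c1 c2) (1 + max k1 k2) Q R M"
  unfolding wp_def
proof (intro allI impI)
  fix b assume b: "\<beta> < b" "bounded_state b R M"
  let ?k = "max k1 k2"
  obtain c where c: "c = (if R r > 0 then c1 else c2)" by simp
  have "wp c ?k Q R M" unfolding c using assms
    by (cases "R r > 0") (auto intro: wp_le[OF _ max.cobounded1] wp_le[OF _ max.cobounded2])
  then obtain t R' M' where 1: "exec n d indep f c (R, M) t (R', M')" "t \<le> ?k * step_cost (b + ?k)"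
    "bounded_state (b + ?k) R' M'" "Q R' M'"
    using wpE b by blast
  have "exec n d indep f (If r c1 c2) (R, M) (1 + bin_length (R r) + t) (R', M')"
    using 1(1) by (cases "R r > 0") (auto simp: c intro: exec.If_True[simplified] exec.If_False[simplified])
  moreover have "bounded_state (b + (1 + max k1 k2)) R' M'"
    by (rule bounded_state_mono[OF 1(3)]) linarith
  ultimately show "\<exists>t R' M'. exec n d indep f (If r c1 c2) (R, M) t (R', M') \<and>
      t \<le> (1 + ?k) * step_cost (b + (1 + ?k)) \<and> bounded_state (b + (1 + ?k)) R' M' \<and> Q R' M'"
    using test_cost_le[OF b(2) 1(2), of r] 1(4) by blast
qed

lemma wp_While_False:
  assumes "R r \<le> 0" "Q R M"
  shows "wp (While r c) 1 Q R M"
proof (rule wp_stepI[where Q = Q, OF _ assms(2)])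
  fix b assume b: "\<beta> < b" "bounded_state b R M"
  have "1 + bin_length (R r) \<le> step_cost b"
    using bin_length_reg[OF b(2), of r] by (simp add: step_cost_def)
  moreover have "bounded_state (Suc b) R M" using b by (auto intro: bounded_state_mono)
  ultimately show "\<exists>t. exec n d indep f (While r c) (R, M) t (R, M) \<and> t \<le> step_cost b \<and>
      bounded_state (Suc b) R M"
    using exec.While_False[where R = R and r = r, OF assms(1)] by blast
qed

lemma wp_While_True:
  assumes "R r > 0" "wp (Seq c (While r c)) k Q R M"
  shows "wp (While r c) (1 + k) Q R M"
  unfolding wp_def
proof (intro allI impI)
  fix b assume b: "\<beta> < b" "bounded_state b R M"
  obtain t R' M' where 1: "exec n d indep f (Seq c (While r c)) (R, M) t (R', M')"
    "t \<le> k * step_cost (b + k)" "bounded_state (b + k) R' M'" "Q R' M'"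
    using wpE[OF assms(2) b] by blast
  from 1(1) have "exec n d indep f (While r c) (R, M) (1 + bin_length (R r) + t) (R', M')"
    by (rule exec_SeqE) (use exec.While_True[where R = R and r = r, OF assms(1)] in \<open>simp add: add.assoc\<close>)
  moreover have "bounded_state (b + (1 + k)) R' M'"
    by (rule bounded_state_mono[OF 1(3)]) simp
  ultimately show "\<exists>t R' M'. exec n d indep f (While r c) (R, M) t (R', M') \<and>
      t \<le> (1 + k) * step_cost (b + (1 + k)) \<and> bounded_state (b + (1 + k)) R' M' \<and> Q R' M'"
    using test_cost_le[OF b(2) 1(2), of r] 1(4) by blast
qed

lemmas wp_intros = wp_Seq wp_If wp_Skip wp_Const wp_Add wp_Sub wp_Load wp_Store wp_Query_Indep wp_Query_Le

text \<open>\<open>P i\<close> describes the state with \<open>i\<close> rounds to go; counting down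
  suits a machine that only tests positivity. The updates of registers \<open>1\<close> and
  \<open>r\<close> anticipate the decrement that ends a round. Besides the bodies, the bound counts
  test, \<open>Const\<close> and \<open>Sub\<close> in each round, and two set-up steps with the
  last test.\<close>

lemma wp_For:
  assumes \<beta>: "1 \<le> \<beta>" and u: "R u = int m" "u \<noteq> 1" and X: "wreg body \<subseteq> X" "wmem body \<subseteq> Y" "r \<notin> X" "r \<noteq> 1"
    and init: "P m (R(1 := 0, r := int m)) M"
    and body: "\<And>i R' M'. i < m \<Longrightarrow> R' r = int (Suc i) \<Longrightarrow> P (Suc i) R' M' \<Longrightarrow>
        (\<And>x. x \<notin> X \<Longrightarrow> x \<noteq> 1 \<Longrightarrow> x \<noteq> r \<Longrightarrow> R' x = R x) \<Longrightarrow> (\<And>y. y \<notin> Y \<Longrightarrow> M' y = M y) \<Longrightarrow>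
        wp body k (\<lambda>R'' M''. P i (R''(1 := 1, r := int i)) M'') R' M'"
    and final: "\<And>R' M'. P 0 R' M' \<Longrightarrow> R' r = 0 \<Longrightarrow>
        (\<And>x. x \<notin> X \<Longrightarrow> x \<noteq> 1 \<Longrightarrow> x \<noteq> r \<Longrightarrow> R' x = R x) \<Longrightarrow> (\<And>y. y \<notin> Y \<Longrightarrow> M' y = M y) \<Longrightarrow> Q R' M'"
  shows "wp (For r u body) (m * (k + 3) + 3) Q R M"
proof -
  let ?loop = "While r (Seq body (Seq (Const 1 1) (Sub r r 1)))"
  have loop: "wp ?loop (i * (k + 3) + 1) Q R' M'"
    if "i \<le> m" "R' r = int i" "P i R' M'" "\<And>x. x \<notin> X \<Longrightarrow> x \<noteq> 1 \<Longrightarrow> x \<noteq> r \<Longrightarrow> R' x = R x"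
      "\<And>y. y \<notin> Y \<Longrightarrow> M' y = M y" for i R' M'
    using that
  proof (induction i arbitrary: R' M')
    case 0
    show ?case by (rule wp_le, rule wp_While_False) (use 0 final in auto)
  next
    case (Suc i)
    have iter: "wp (Seq (Seq body (Seq (Const 1 1) (Sub r r 1))) ?loop) ((k + (1 + 1)) + (i * (k + 3) + 1)) Q R' M'"
    proof (intro wp_Seq, rule wp_mono[OF body order.refl])
      fix R'' M'' assume P: "P i (R''(1 := 1, r := int i)) M''" and fr: "\<And>x. x \<notin> wreg body \<Longrightarrow> R'' x = R' x"
        "\<And>y. y \<notin> wmem body \<Longrightarrow> M'' y = M' y"
      have "r \<notin> wreg body" using X(1,3) by blast
      then have r: "R'' r = int i + 1" using fr(1)[of r] Suc.prems(2) by simp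
      have "wp ?loop (i * (k + 3) + 1) Q (R''(1 := 1, r := int i)) M''"
        using X fr Suc.prems by (intro Suc.IH P) (auto simp: subset_iff, (metis+)?)
      then have "wp ?loop (i * (k + 3) + 1) Q (R''(1 := 1, r := (R''(1 := 1)) r - (R''(1 := 1)) 1)) M''"
        using r X by simp
      then show "wp (Seq (Const 1 1) (Sub r r 1)) (1 + 1) (wp ?loop (i * (k + 3) + 1) Q) R'' M''"
        using \<beta> by (intro wp_Seq wp_Const wp_Sub) auto
    qed (use Suc.prems in auto)
    show ?case
      by (rule wp_le, rule wp_While_True[OF _ iter]) (use Suc.prems in auto)
  qed
  have "wp ?loop (m * (k + 3) + 1) Q (R(1 := 0, r := int m)) M"
    by (rule loop) (use init in auto)
  then have "wp ?loop (m * (k + 3) + 1) Q (R(1 := 0, r := (R(1 := 0)) u + (R(1 := 0)) 1)) M"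
    using u by simp
  then have "wp (For r u body) (1 + (1 + (m * (k + 3) + 1))) Q R M"
    unfolding For_def by (intro wp_Seq wp_Const wp_Add) auto
  then show ?thesis by (rule wp_le) simp
qed

lemma wp_unroll:
  assumes X: "\<And>i. i < m \<Longrightarrow> wreg (c (Suc i)) \<subseteq> X" "\<And>i. i < m \<Longrightarrow> wmem (c (Suc i)) \<subseteq> Y"
    and init: "P 0 R M"
    and step: "\<And>i R' M'. i < m \<Longrightarrow> P i R' M' \<Longrightarrow> (\<And>x. x \<notin> X \<Longrightarrow> R' x = R x) \<Longrightarrow>
        (\<And>y. y \<notin> Y \<Longrightarrow> M' y = M y) \<Longrightarrow> wp (c (Suc i)) k (P (Suc i)) R' M'"
    and final: "\<And>R' M'. P m R' M' \<Longrightarrow> (\<And>x. x \<notin> X \<Longrightarrow> R' x = R x) \<Longrightarrow>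
        (\<And>y. y \<notin> Y \<Longrightarrow> M' y = M y) \<Longrightarrow> Q R' M'"
  shows "wp (unroll c m) (m * k + 1) Q R M"
proof -
  have "wp (unroll c i) (1 + i * k) (\<lambda>R' M'. P i R' M' \<and> (\<forall>x. x \<notin> X \<longrightarrow> R' x = R x) \<and>
      (\<forall>y. y \<notin> Y \<longrightarrow> M' y = M y)) R M" if "i \<le> m" for i
    using that
  proof (induction i)
    case 0
    then show ?case using init by (auto intro: wp_Skip[simplified])
  next
    case (Suc i)
    have "wp (unroll c (Suc i)) ((1 + i * k) + k) (\<lambda>R' M'. P (Suc i) R' M' \<and> (\<forall>x. x \<notin> X \<longrightarrow> R' x = R x) \<and>
      (\<forall>y. y \<notin> Y \<longrightarrow> M' y = M y)) R M"
      unfolding unroll.simps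
    proof (rule wp_Seq, rule wp_mono[OF Suc.IH order.refl])
      fix R' M'
      assume "P i R' M' \<and> (\<forall>x. x \<notin> X \<longrightarrow> R' x = R x) \<and> (\<forall>y. y \<notin> Y \<longrightarrow> M' y = M y)"
      then show "wp (c (Suc i)) k (\<lambda>R' M'. P (Suc i) R' M' \<and> (\<forall>x. x \<notin> X \<longrightarrow> R' x = R x) \<and>
          (\<forall>y. y \<notin> Y \<longrightarrow> M' y = M y)) R' M'"
        using X[of i] Suc.prems by (intro wp_mono[OF step order.refl]) (auto simp: subset_iff, (metis+)?)
    qed (use Suc.prems in simp)
    then show ?case by (rule wp_le) simp
  qed
  from wp_mono[OF this[OF order.refl]] show ?thesis using final by simp
qed

text \<open>The loop counter at depth \<open>i\<close> runs down from \<open>b\<close> to \<open>1\<close>, so that cell \<open>i\<close> of memory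
  \<open>mem\<close> runs down from \<open>b - 1\<close> to \<open>0\<close>; \<open>V\<close> collects the memory contents already visited.\<close>

lemma wp_enum:
  assumes \<beta>: "1 \<le> \<beta>" "K \<le> \<beta>" and bnd: "R0 bnd = int b" "bnd \<notin> wreg body" "3 < bnd" "bnd < base"
    and base: "\<And>i. i < K \<Longrightarrow> base + i \<notin> wreg body" and mem: "mem \<notin> wmem body"
    and stable: "\<And>V R M R' M'. I V R M \<Longrightarrow> (\<And>r. r \<notin> {1, 2, 3} \<union> {base..<base + K} \<Longrightarrow> R' r = R r) \<Longrightarrow>
        (\<And>y. y \<noteq> mem \<Longrightarrow> M' y = M y) \<Longrightarrow> I V R' M'"
    and body: "\<And>V R M. I V R M \<Longrightarrow>
        (\<And>r. r \<notin> {1, 2, 3} \<union> {base..<base + K} \<union> wreg body \<Longrightarrow> R r = R0 r) \<Longrightarrow>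
        (\<And>y. y \<notin> insert mem (wmem body) \<Longrightarrow> M y = M0 y) \<Longrightarrow>
        (\<And>x. x \<in> {1..int K} \<Longrightarrow> M mem x \<in> {0..<int b}) \<Longrightarrow> wp body t (I (insert (M mem) V)) R M"
    and init: "I {} R0 M0"
    and final: "\<And>V R M. I V R M \<Longrightarrow>
        (\<And>h. (\<And>x. x \<in> {1..int K} \<Longrightarrow> h x \<in> {0..<int b}) \<Longrightarrow>
          (\<And>x. x \<notin> {1..int K} \<Longrightarrow> h x = M0 mem x) \<Longrightarrow> h \<in> V) \<Longrightarrow> Q R M"
  shows "wp (enum base mem bnd body K) (enum_time b t K) Q R0 M0"
proof -
  let ?X = "\<lambda>k. {1, 2, 3} \<union> {base..<base + k} \<union> wreg body" and ?Y = "insert mem (wmem body)"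
  \<comment> \<open>A partial run over the lowest \<open>k\<close> digits: all vectors whose digit
    \<open>k\<close> is at least \<open>i\<close> have been seen, as the counter descends. For
    \<open>k = 0\<close> the guard leaves just the vector in memory.\<close>
  define visited where "visited k i M V V' M' \<longleftrightarrow> V \<subseteq> V' \<and>
      (\<forall>x. x \<notin> {1..int k} \<longrightarrow> M' mem x = M mem x) \<and>
      (\<forall>h. (\<forall>x\<in>{1..int k}. h x \<in> {0..<int b}) \<longrightarrow> (0 < k \<longrightarrow> i \<le> h (int k)) \<longrightarrow>
        (\<forall>x. x \<notin> {1..int k} \<longrightarrow> h x = M mem x) \<longrightarrow> h \<in> V')"
    for k i and M :: mems and V V' :: "(int \<Rightarrow> int) set" and M' :: mems
  have "wp (enum base mem bnd body k) (enum_time b t k) (\<lambda>R' M'. \<exists>V'. I V' R' M' \<and> visited k 0 M V V' M') R M"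
    if "k \<le> K" "I V R M" "\<And>r. r \<notin> ?X K \<Longrightarrow> R r = R0 r" "\<And>y. y \<notin> ?Y \<Longrightarrow> M y = M0 y"
      "\<And>x. x \<in> {int k<..int K} \<Longrightarrow> M mem x \<in> {0..<int b}" for k V R M
    using that
  proof (induction k arbitrary: V R M)
    case 0
    have "wp body t (I (insert (M mem) V)) R M"
      by (rule body) (use 0 in auto)
    then show ?case unfolding enum.simps enum_time.simps
    proof (rule wp_mono[OF _ order.refl])
      fix R' M' assume I: "I (insert (M mem) V) R' M'" and fr: "\<And>y. y \<notin> wmem body \<Longrightarrow> M' y = M y"
      have "visited 0 0 M V (insert (M mem) V) M'"
        using fr mem by (auto simp: visited_def fun_eq_iff[symmetric])
      then show "\<exists>V'. I V' R' M' \<and> visited 0 0 M V V' M'" using I by blast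
    qed
  next
    case (Suc k)
    let ?r = "base + k" and ?P = "\<lambda>i R' M'. \<exists>V'. I V' R' M' \<and> visited (Suc k) (int i) M V V' M'"
    let ?body = "Seq (Const 1 1) (Seq (Sub 2 (base + k) 1) (Seq (Const 3 (int (Suc k))) (Seq (Store mem 3 2)
       (enum base mem bnd body k))))"
    have "wp (For ?r bnd ?body) (b * ((4 + enum_time b t k) + 3) + 3) (\<lambda>R' M'. \<exists>V'. I V' R' M' \<and> visited (Suc k) 0 M V V' M') R M"
    proof (rule wp_For[where P = ?P and X = "?X k" and Y = ?Y])
      show "R bnd = int b" using Suc.prems(3)[of bnd] bnd by auto
      show "wreg ?body \<subseteq> ?X k" using wreg_enum[of base mem bnd body k] by auto
      show "wmem ?body \<subseteq> ?Y" using wmem_enum[of base mem bnd body k] by auto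
      show "?r \<notin> ?X k" using base[of k] Suc.prems(1) bnd by auto
      show "?P b (R(1 := 0, ?r := int b)) M"
      proof (intro exI conjI)
        show "I V (R(1 := 0, ?r := int b)) M"
          by (rule stable[OF Suc.prems(2)]) (use Suc.prems(1) in auto)
        \<comment> \<open>Vacuous at the start: no digit reaches \<open>b\<close>.\<close>
        show "visited (Suc k) (int b) M V V M" unfolding visited_def by force
      qed
    next
      fix i R' M'
      assume i: "i < b" "R' ?r = int (Suc i)" and P: "?P (Suc i) R' M'"
        and frR: "\<And>x. x \<notin> ?X k \<Longrightarrow> x \<noteq> 1 \<Longrightarrow> x \<noteq> ?r \<Longrightarrow> R' x = R x" and frM: "\<And>y. y \<notin> ?Y \<Longrightarrow> M' y = M y"
      obtain V' where V': "I V' R' M'" "visited (Suc k) (int (Suc i)) M V V' M'" using P by blast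
      define R1 where "R1 = R'(1 := 1, 2 := int i, 3 := int (Suc k))"
      define M1 where "M1 = M'(mem := (M' mem)(int (Suc k) := int i))"
      have "wp (enum base mem bnd body k) (enum_time b t k) (\<lambda>R' M'. \<exists>V''. I V'' R' M' \<and> visited k 0 M1 V' V'' M') R1 M1"
      proof (rule Suc.IH)
        show "I V' R1 M1" by (rule stable[OF V'(1)]) (auto simp: R1_def M1_def)
        show "R1 x = R0 x" if "x \<notin> ?X K" for x
          using frR[of x] Suc.prems(1) Suc.prems(3)[OF that] that by (auto simp: R1_def)
        show "M1 y = M0 y" if "y \<notin> ?Y" for y
          using frM[OF that] Suc.prems(4)[OF that] that by (auto simp: M1_def)
        show "M1 mem x \<in> {0..<int b}" if "x \<in> {int k<..int K}" for x
          using Suc.prems(5)[of x] V'(2) that i unfolding visited_def M1_def by auto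
      qed (use Suc.prems in simp)
      then have enum: "wp (enum base mem bnd body k) (enum_time b t k)
          (\<lambda>R'' M''. ?P i (R''(1 := 1, ?r := int i)) M'') R1 M1"
      proof (rule wp_mono[OF _ order.refl])
        fix R'' M'' assume "\<exists>V''. I V'' R'' M'' \<and> visited k 0 M1 V' V'' M''"
        then obtain V'' where V'': "I V'' R'' M''" "visited k 0 M1 V' V'' M''" by blast
        have "I V'' (R''(1 := 1, ?r := int i)) M''"
          by (rule stable[OF V''(1)]) (use Suc.prems(1) in auto)
        moreover have "visited (Suc k) (int i) M V V'' M''"
          unfolding visited_def
        proof (intro conjI allI impI)
          show "V \<subseteq> V''" using V'(2) V''(2) by (auto simp: visited_def)
          show "M'' mem x = M mem x" if "x \<notin> {1..int (Suc k)}" for x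
            using V'(2) V''(2) that by (auto simp: visited_def M1_def)
          fix h assume h: "\<forall>x\<in>{1..int (Suc k)}. h x \<in> {0..<int b}" "0 < Suc k \<longrightarrow> int i \<le> h (int (Suc k))"
            "\<forall>x. x \<notin> {1..int (Suc k)} \<longrightarrow> h x = M mem x"
          show "h \<in> V''"
          \<comment> \<open>Vectors with leading digit exactly \<open>i\<close> were covered by the
            inner run just finished, those with a larger one in earlier rounds.\<close>
          proof (cases "h (int (Suc k)) = int i")
            case True
            have "h x = M1 mem x" if "x \<notin> {1..int k}" for x
            proof (cases "x = int (Suc k)")
              case False
              then have "x \<notin> {1..int (Suc k)}" using that by auto
              then show ?thesis using h(3) V'(2) False by (auto simp: visited_def M1_def)
            qed (use True in \<open>simp add: M1_def add.commute\<close>)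
            then show ?thesis using V''(2) h(1) unfolding visited_def by auto
          next
            case False
            then have "h \<in> V'" using V'(2) h unfolding visited_def by auto
            then show ?thesis using V''(2) by (auto simp: visited_def)
          qed
        qed
        ultimately show "?P i (R''(1 := 1, ?r := int i)) M''" by blast
      qed
      have r: "?r \<notin> {1, 2, 3}" using bnd by auto
      have "wp ?body (1 + (1 + (1 + (1 + enum_time b t k)))) (\<lambda>R'' M''. ?P i (R''(1 := 1, ?r := int i)) M'') R' M'"
        apply (intro wp_Seq wp_Const wp_Sub wp_Store)
        using enum r i \<beta> Suc.prems(1) by (simp_all add: R1_def M1_def)
      then show "wp ?body (4 + enum_time b t k) (\<lambda>R'' M''. ?P i (R''(1 := 1, ?r := int i)) M'') R' M'"
        by (rule wp_le) simp
    qed (use \<beta> bnd in auto)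
    then show ?case by (simp add: add.commute add.left_commute)
  qed
  from this[of K "{}" R0 M0] init have
    "wp (enum base mem bnd body K) (enum_time b t K) (\<lambda>R' M'. \<exists>V'. I V' R' M' \<and> visited K 0 M0 {} V' M') R0 M0"
    by auto
  then show ?thesis
  proof (rule wp_mono[OF _ order.refl])
    fix R' M' assume "\<exists>V'. I V' R' M' \<and> visited K 0 M0 {} V' M'"
    then obtain V' where V': "I V' R' M'" "visited K 0 M0 {} V' M'" by blast
    show "Q R' M'"
      by (rule final[OF V'(1)]) (use V'(2) in \<open>auto simp: visited_def\<close>)
  qed
qed

end

section \<open>The algorithm\<close>

abbreviation seq (infixr ";;" 60) where "c1 ;; c2 \<equiv> Seq c1 c2"

definition fill :: "nat \<Rightarrow> nat \<Rightarrow> com" where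
  "fill k v = For 6 0 (Store k 6 v)"

definition copy_cells :: "nat \<Rightarrow> nat \<Rightarrow> nat \<Rightarrow> com" where
  "copy_cells u src dst = For 6 u (Load 2 src 6;; Store dst 6 2)"

definition select_sum :: "nat \<Rightarrow> nat \<Rightarrow> nat \<Rightarrow> com" where
  "select_sum u sel val = Const 9 0;;
     For 6 u (Load 2 sel 6;; If 2 (Load 3 val 6;; Add 9 9 3) Skip)"

lemma frame_basic [simp]:
  "wreg (fill k v) = {1, 6}" "wmem (fill k v) = {k}"
  "wreg (copy_cells u src dst) = {1, 2, 6}" "wmem (copy_cells u src dst) = {dst}"
  "wreg (select_sum u sel val) = {1, 2, 3, 6, 9}" "wmem (select_sum u sel val) = {}"
  by (auto simp: fill_def copy_cells_def select_sum_def)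

section \<open>Filling, copying and selective summation of cells\<close>

context machine
begin

lemma wp_fill:
  assumes "1 \<le> \<beta>" "R 0 = int n" "v \<noteq> 1" "v \<noteq> 6"
  shows "wp (fill k v) (n * 4 + 3) (\<lambda>R' M'. M' k = (\<lambda>x. if x \<in> {1..int n} then R v else M k x)) R M"
proof -
  have "wp (fill k v) (n * (1 + 3) + 3) (\<lambda>R' M'. M' k = (\<lambda>x. if x \<in> {1..int n} then R v else M k x)) R M"
    unfolding fill_def
    by (rule wp_For[where X = "{}" and Y = "{k}" and
          P = "\<lambda>i R' M'. M' k = (\<lambda>x. if x \<in> {int i<..int n} then R v else M k x)"])
       (use assms in \<open>auto intro!: wp_Store[simplified] simp: fun_eq_iff\<close>)
  then show ?thesis by simp
qed

lemma wp_copy_cells: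
  assumes "1 \<le> \<beta>" "R u = int m" "u \<noteq> 1" "src \<noteq> dst"
  shows "wp (copy_cells u src dst) (m * 5 + 3)
    (\<lambda>R' M'. M' dst = (\<lambda>x. if x \<in> {1..int m} then M src x else M dst x)) R M"
proof -
  have "wp (copy_cells u src dst) (m * ((1 + 1) + 3) + 3)
    (\<lambda>R' M'. M' dst = (\<lambda>x. if x \<in> {1..int m} then M src x else M dst x)) R M"
    unfolding copy_cells_def
  proof (rule wp_For[where X = "{2}" and Y = "{dst}" and
        P = "\<lambda>i R' M'. M' dst = (\<lambda>x. if x \<in> {int i<..int m} then M src x else M dst x)"], goal_cases)
    case (9 i R' M')
    show ?case by (intro wp_Seq wp_Load wp_Store) (use 9 assms in \<open>auto simp: fun_eq_iff\<close>)
  qed (use assms in \<open>auto simp: fun_eq_iff\<close>)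
  then show ?thesis by simp
qed

lemma wp_select_sum:
  assumes "1 \<le> \<beta>" "R u = int m" "u \<notin> {1, 2, 3, 6, 9}"
  shows "wp (select_sum u sel val) (m * 7 + 4)
    (\<lambda>R' M'. R' 9 = (\<Sum>x\<in>{x \<in> {1..int m}. 0 < M sel x}. M val x) \<and> M' = M) R M"
proof -
  \<comment> \<open>The index descends, so each round contributes the least element of the enlarged
    interval.\<close>
  have step: "(\<Sum>x\<in>{x \<in> {int i<..int m}. 0 < M sel x}. M val x) =
      (if 0 < M sel (1 + int i) then M val (1 + int i) else 0) +
      (\<Sum>x\<in>{x \<in> {1 + int i<..int m}. 0 < M sel x}. M val x)" if "i < m" for i
  proof -
    have eq: "{x \<in> {int i<..int m}. 0 < M sel x} =
       (if 0 < M sel (1 + int i) then insert (1 + int i) {x \<in> {1 + int i<..int m}. 0 < M sel x}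
        else {x \<in> {1 + int i<..int m}. 0 < M sel x})"
      using that by (auto simp: less_le)
    have "finite {x. 1 + int i < x \<and> x \<le> int m \<and> 0 < M sel x}"
      by (rule finite_subset[of _ "{1 + int i<..int m}"]) auto
    then show ?thesis by (subst eq) auto
  qed
  have "wp (select_sum u sel val) (1 + (m * ((1 + (1 + max (1 + 1) 1)) + 3) + 3))
    (\<lambda>R' M'. R' 9 = (\<Sum>x\<in>{x \<in> {1..int m}. 0 < M sel x}. M val x) \<and> M' = M) R M"
    unfolding select_sum_def
  proof (rule wp_Seq, rule wp_Const)
    show "wp (For 6 u (Load 2 sel 6;; If 2 (Load 3 val 6;; Add 9 9 3) Skip)) (m * ((1 + (1 + max (1 + 1) 1)) + 3) + 3)
       (\<lambda>R' M'. R' 9 = (\<Sum>x\<in>{x \<in> {1..int m}. 0 < M sel x}. M val x) \<and> M' = M) (R(9 := 0)) M"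
    proof (rule wp_For[where X = "{2, 3, 9}" and Y = "{}" and
          P = "\<lambda>i R' M'. R' 9 = (\<Sum>x\<in>{x \<in> {int i<..int m}. 0 < M sel x}. M val x) \<and> M' = M"], goal_cases)
      case (9 i R' M')
      show ?case
        by (intro wp_Seq wp_Load wp_If wp_Add wp_Skip)
           (use 9 step[of i] in \<open>auto\<close>)
    next
      case (10 R' M')
      have "{int 0<..int m} = {1..int m}" by auto
      with 10 show ?case by (simp del: greaterThanAtMost_iff atLeastAtMost_iff)
    qed (use assms in auto)
  qed auto
  then show ?thesis by (rule wp_le) simp
qed

end

text \<open>Sharper than \<open>set_of_cells\<close>: with cells equal to 0 or 1, positivity tests
  agree with membership and the sum of the cells is the cardinality.\<close>

definition indicates :: "nat \<Rightarrow> (int \<Rightarrow> int) \<Rightarrow> nat set \<Rightarrow> bool" where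
  "indicates n A S \<longleftrightarrow> S \<subseteq> {1..n} \<and> (\<forall>x\<in>{1..n}. A (int x) = (if x \<in> S then 1 else 0))"

lemma set_of_cells_indicates: "indicates n A S \<Longrightarrow> set_of_cells n A = S"
  by (auto simp: indicates_def set_of_cells_def split: if_splits)

lemma sum_selected_indicates:
  assumes "indicates n A S"
  shows "(\<Sum>x\<in>{x \<in> {1..int n}. 0 < A x}. g x) = (\<Sum>x\<in>S. g (int x))"
proof -
  have "{x \<in> {1..int n}. 0 < A x} = int ` S"
  proof (intro equalityI subsetI)
    fix x assume x: "x \<in> {x \<in> {1..int n}. 0 < A x}"
    then have "x = int (nat x)" "nat x \<in> {1..n}" by auto
    then obtain y where "x = int y" "y \<in> {1..n}" by blast
    then show "x \<in> int ` S" using x assms by (auto simp: indicates_def split: if_splits)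
  qed (use assms in \<open>auto simp: indicates_def subset_iff\<close>)
  then show ?thesis by (simp add: sum.reindex)
qed

text \<open>Memory layout: \<open>d + 1\<close> best set so far, \<open>d + 2\<close> colours, \<open>d + 3\<close> quotas, \<open>d + 4\<close> set of
  colours, \<open>d + 5\<close> candidate set, \<open>d + 6\<close> greedy independent set, \<open>d + 7\<close> and \<open>d + 8\<close> profiles of
  the candidate and of the best set. Register \<open>10\<close> holds the size of the best set.\<close>

definition greedy :: "nat \<Rightarrow> com" where
  "greedy d = For 6 0 (Load 2 (d + 5) 6;; If 2
     (Load 3 (d + 2) 6;; Load 4 (d + 4) 3;; If 4
       (Const 5 1;; Store (d + 6) 6 5;; Query_Indep 2 (d + 6);;
        If 2 (Sub 9 9 5) (Const 5 0;; Store (d + 6) 6 5)) Skip) Skip)"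

text \<open>Register \<open>9\<close> starts as the quota sum and \<open>greedy\<close> subtracts
  one for each accepted element, so a positive remainder exposes a violated condition. Register
  \<open>8\<close> is a flag that is only ever lowered.\<close>

definition test_colours :: "nat \<Rightarrow> nat \<Rightarrow> com" where
  "test_colours d K = Const 7 (int K);; select_sum 7 (d + 4) (d + 3);; Const 3 0;; fill (d + 6) 3;;
     greedy d;; If 9 (Const 8 0) Skip"

definition check_quota :: "nat \<Rightarrow> nat \<Rightarrow> com" where
  "check_quota d K = Const 8 1;; Const 12 2;; enum 20 (d + 4) 12 (test_colours d K) K"

definition delete_all :: "nat \<Rightarrow> nat \<Rightarrow> com" where
  "delete_all d K = For 13 0 (Const 2 0;; Store (d + 5) 13 2;; check_quota d K;;
     If 8 Skip (Const 2 1;; Store (d + 5) 13 2))"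

text \<open>The final sum runs over the indicator cells themselves and leaves the size of the
  candidate in register \<open>9\<close>; it comes last because the weight sums use the same
  register.\<close>

definition evaluate :: "nat \<Rightarrow> com" where
  "evaluate d =
     unroll (\<lambda>k. select_sum 0 (d + 5) k;; Const 2 (int k);; Store (d + 7) 2 9) d;;
     select_sum 0 (d + 5) (d + 5)"

definition save_best :: "nat \<Rightarrow> com" where
  "save_best d = Const 4 0;; Add 10 9 4;; copy_cells 0 (d + 5) (d + 1);;
     Const 5 (int d);; copy_cells 5 (d + 7) (d + 8)"

text \<open>Infeasible quotas may leave a dependent candidate, hence the initial independence query.
  A positive size difference settles the matter; adding 1 to a difference that is not positive
  isolates equal sizes, the only case in which \<open>f\<close> is consulted.\<close>

definition compare :: "nat \<Rightarrow> com" where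
  "compare d = Query_Indep 2 (d + 5);; If 2
     (evaluate d;; Sub 2 9 10;; If 2 (Const 3 1)
        (Const 4 1;; Add 2 2 4;; If 2 (Query_Le 3 (d + 7) (d + 8)) (Const 3 0));;
      If 3 (save_best d) Skip) Skip"

definition try_quota :: "nat \<Rightarrow> nat \<Rightarrow> com" where
  "try_quota d K = Const 2 1;; fill (d + 5) 2;; delete_all d K;; compare d"

text \<open>Register \<open>11\<close> holds \<open>n + 1\<close>, so that each quota ranges from 0
  to \<open>n\<close>. The counters start at \<open>20 + K\<close> because those from 20 on serve
  the inner enumeration of colour sets.\<close>

definition search :: "nat \<Rightarrow> nat \<Rightarrow> com" where
  "search d K = Const 2 1;; Add 11 0 2;; enum (20 + K) (d + 3) 11 (try_quota d K) K"

text \<open>The time bounds are left in the shape in which the \<open>wp\<close> rules build them,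
  so that the rules apply by unification. All that matters later is polynomial growth in
  \<open>n\<close>.\<close>

definition colour_test_time :: "nat \<Rightarrow> nat \<Rightarrow> nat" where
  "colour_test_time n K = 1 + ((K * 7 + 4) + (1 + ((n * 4 + 3) + ((n * 14 + 3) + (1 + max 1 1)))))"

definition delete_time :: "nat \<Rightarrow> nat \<Rightarrow> nat" where
  "delete_time n K = n * (1 + (1 + (1 + (1 + enum_time 2 (colour_test_time n K) K) + (1 + max 1 (1 + 1)))) + 3) + 3"

definition evaluate_time :: "nat \<Rightarrow> nat \<Rightarrow> nat" where
  "evaluate_time n d = (d * ((n * 7 + 4) + (1 + 1)) + 1) + (n * 7 + 4)"

definition save_time :: "nat \<Rightarrow> nat \<Rightarrow> nat" where
  "save_time n d = 1 + (1 + ((n * 5 + 3) + (1 + (d * 5 + 3))))"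

definition compare_time :: "nat \<Rightarrow> nat \<Rightarrow> nat" where
  "compare_time n d = 1 + (1 + max (evaluate_time n d + (1 + ((1 + max 1 (1 + (1 + (1 + max 1 1)))) +
     (1 + max (save_time n d) 1)))) 1)"

definition try_time :: "nat \<Rightarrow> nat \<Rightarrow> nat \<Rightarrow> nat" where
  "try_time n d K = 1 + ((n * 4 + 3) + (delete_time n K + compare_time n d))"

definition match_time :: "nat \<Rightarrow> nat" where
  "match_time d = 1 + ((d * (1 + (1 + (1 + (1 + ((1 + max 1 1) + (1 + (1 + max 1 1))))))) + 1) + (1 + max (1 + 1) 1))"

section \<open>Registers and memories written by the subprograms\<close>

lemma frame_greedy [simp]: "wreg (greedy d) = {1, 2, 3, 4, 5, 6, 9}" "wmem (greedy d) = {d + 6}"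
  by (auto simp: greedy_def)

lemma frame_test_colours [simp]:
  "wreg (test_colours d K) = {1, 2, 3, 4, 5, 6, 7, 8, 9}" "wmem (test_colours d K) = {d + 6}"
  by (auto simp: test_colours_def)

lemma frame_check_quota:
  "wreg (check_quota d K) \<subseteq> {1, 2, 3, 4, 5, 6, 7, 8, 9, 12} \<union> {20..<20 + K}"
  "wmem (check_quota d K) \<subseteq> {d + 4, d + 6}"
  using wreg_enum[of 20 "d + 4" 12 "test_colours d K" K] wmem_enum[of 20 "d + 4" 12 "test_colours d K" K]
  by (auto simp: check_quota_def)

lemma frame_delete_all:
  "wreg (delete_all d K) \<subseteq> {1, 2, 3, 4, 5, 6, 7, 8, 9, 12, 13} \<union> {20..<20 + K}"
  "wmem (delete_all d K) \<subseteq> {d + 4, d + 5, d + 6}"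
  using frame_check_quota[of d K] by (auto simp: delete_all_def)

lemma frame_evaluate:
  "wreg (evaluate d) \<subseteq> {1, 2, 3, 6, 9}" "wmem (evaluate d) \<subseteq> {d + 7}"
proof -
  let ?c = "\<lambda>k. select_sum 0 (d + 5) k;; Const 2 (int k);; Store (d + 7) 2 9"
  have "wreg (unroll ?c d) \<subseteq> {1, 2, 3, 6, 9}" "wmem (unroll ?c d) \<subseteq> {d + 7}"
    by (rule wreg_unroll wmem_unroll; simp)+
  then show "wreg (evaluate d) \<subseteq> {1, 2, 3, 6, 9}" "wmem (evaluate d) \<subseteq> {d + 7}"
    by (auto simp: evaluate_def)
qed

lemma frame_save_best [simp]: "wreg (save_best d) = {1, 2, 4, 5, 6, 10}" "wmem (save_best d) = {d + 1, d + 8}"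
  by (auto simp: save_best_def)

lemma frame_compare:
  "wreg (compare d) \<subseteq> {1, 2, 3, 4, 5, 6, 9, 10}" "wmem (compare d) \<subseteq> {d + 1, d + 7, d + 8}"
  using frame_evaluate[of d] by (auto simp: compare_def)

lemma frame_try_quota:
  "wreg (try_quota d K) \<subseteq> {1, 2, 3, 4, 5, 6, 7, 8, 9, 10, 12, 13} \<union> {20..<20 + K}"
  "wmem (try_quota d K) \<subseteq> {d + 1, d + 4, d + 5, d + 6, d + 7, d + 8}"
  using frame_delete_all[of d K] frame_compare[of d] by (auto simp: try_quota_def)

text \<open>The search relies only on the weights factoring through the colours; \<open>wt\<close>
  is the factor. How the colouring arises is left to the interpretation.\<close>

locale quota_search = matroid "{1..n}" indep + machine n d indep f \<beta>
  for n d :: nat and indep :: "nat set \<Rightarrow> bool" and f :: "real list \<Rightarrow> real" and \<beta> :: nat +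
  fixes K :: nat and w :: "nat \<Rightarrow> nat \<Rightarrow> int" and c :: "nat \<Rightarrow> int" and wt :: "nat \<Rightarrow> int \<Rightarrow> int"
  assumes const_bounds: "2 \<le> \<beta>" "K \<le> \<beta>" "d \<le> \<beta>"
    and colour: "x \<in> {1..n} \<Longrightarrow> c x \<in> {1..int K}"
    and weight: "k \<in> {1..d} \<Longrightarrow> x \<in> {1..n} \<Longrightarrow> w k x = wt k (c x)"
begin

definition input_ok :: "regs \<Rightarrow> mems \<Rightarrow> bool" where
  "input_ok R M \<longleftrightarrow> R 0 = int n \<and> (\<forall>x\<in>{1..n}. M (d + 2) (int x) = c x) \<and>
     (\<forall>k\<in>{1..d}. \<forall>x\<in>{1..n}. M k (int x) = w k x)"

lemma input_ok_cong:
  "input_ok R M \<Longrightarrow> R' 0 = R 0 \<Longrightarrow> (\<And>k. 1 \<le> k \<Longrightarrow> k \<le> d \<or> k = d + 2 \<Longrightarrow> M' k = M k) \<Longrightarrow> input_ok R' M'"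
  by (auto simp: input_ok_def)

text \<open>The accepted set stays a maximal independent subset of the relevant elements scanned so
  far: an element once rejected remains dependent on every larger set. At the end maximality gives
  its size as the rank.\<close>

lemma wp_greedy:
  assumes inp: "input_ok R M" and S: "indicates n (M (d + 5)) S" and empty: "indicates n (M (d + 6)) {}"
  shows "wp (greedy d) (n * 14 + 3)
    (\<lambda>R' M'. R' 9 = R 9 - int (rank {x \<in> S. 0 < M (d + 4) (c x)})) R M"
proof -
  define T where "T = {x \<in> S. 0 < M (d + 4) (c x)}"
  have Sn: "S \<subseteq> {1..n}" using S by (simp add: indicates_def)
  have SM: "M (d + 5) (1 + int x) = (if Suc x \<in> S then 1 else 0)"
    and cM: "M (d + 2) (1 + int x) = c (Suc x)" if "x < n" for x
    using that S inp by (auto simp: indicates_def input_ok_def dest!: bspec[of _ _ "Suc x"])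
  define P where "P i R' M' \<longleftrightarrow> (\<exists>I. indicates n (M' (d + 6)) I \<and> I \<subseteq> {x \<in> T. i < x} \<and> indep I \<and>
      (\<forall>x\<in>T - I. i < x \<longrightarrow> \<not> indep (insert x I)) \<and> R' 9 = R 9 - int (card I))"
    for i and R' :: regs and M' :: mems
  have "wp (greedy d) (n * (11 + 3) + 3) (\<lambda>R' M'. R' 9 = R 9 - int (rank T)) R M"
    unfolding greedy_def
  proof (rule wp_For[where X = "{2, 3, 4, 5, 9}" and Y = "{d + 6}" and P = P], goal_cases)
    case 8
    have "\<not> n < x" if "x \<in> T" for x using that Sn by (auto simp: T_def)
    then show ?case using empty indep_empty by (auto simp: P_def intro!: exI[of _ "{}"])
  next
    case (9 i R' M')
    obtain I where I: "indicates n (M' (d + 6)) I" "I \<subseteq> {x \<in> T. Suc i < x}" "indep I"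
      "\<forall>x\<in>T - I. Suc i < x \<longrightarrow> \<not> indep (insert x I)" "R' 9 = R 9 - int (card I)"
      using 9(3) unfolding P_def by blast
    have fr: "M' (d + 5) = M (d + 5)" "M' (d + 2) = M (d + 2)" "M' (d + 4) = M (d + 4)"
      using 9(5) by auto
    have keep: "P i R'' M'" if "Suc i \<notin> T \<or> \<not> indep (insert (Suc i) I)" "R'' 9 = R' 9" for R''
      unfolding P_def
    proof (intro exI[of _ I] conjI ballI impI)
      fix x assume "x \<in> T - I" "i < x"
      then show "\<not> indep (insert x I)" using I(4) that(1) by (cases "x = Suc i") auto
    qed (use I that in auto)
    have notin: "Suc i \<notin> I" using I(2) by auto
    have cell: "M' (d + 6) (1 + int i) = 0"
      using I(1) notin 9(1) by (auto simp: indicates_def dest!: bspec[of _ _ "Suc i"])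
    have ins: "indicates n ((M' (d + 6))(1 + int i := 1)) (insert (Suc i) I)"
      using I(1) 9(1) by (auto simp: indicates_def)
    have finI: "finite I" using I(3) indep_finite by blast
    have add: "P i R'' M''" if "Suc i \<in> T" "indep (insert (Suc i) I)" "R'' 9 = R' 9 - 1"
      "M'' (d + 6) = (M' (d + 6))(1 + int i := 1)" for R'' M''
      unfolding P_def
    proof (intro exI[of _ "insert (Suc i) I"] conjI ballI impI)
      fix x assume x: "x \<in> T - insert (Suc i) I" "i < x"
      then have "\<not> indep (insert x I)" using I(4) by (cases "x = Suc i") auto
      then show "\<not> indep (insert x (insert (Suc i) I))"
        using indep_mono[of "insert x (insert (Suc i) I)" "insert x I"] by blast
    qed (use I that ins notin finI in auto)
    \<comment> \<open>The cell of a rejected element was 0 before the attempt, so writing 0 back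
      restores the memory exactly.\<close>
    have undo: "(M' (d + 6))(1 + int i := 0) = M' (d + 6)" using cell by auto
    have "wp (Load 2 (d + 5) 6;; If 2
         (Load 3 (d + 2) 6;; Load 4 (d + 4) 3;; If 4
           (Const 5 1;; Store (d + 6) 6 5;; Query_Indep 2 (d + 6);;
            If 2 (Sub 9 9 5) (Const 5 0;; Store (d + 6) 6 5)) Skip) Skip)
       (1 + (1 + max (1 + (1 + (1 + max (1 + (1 + (1 + (1 + max 1 (1 + 1))))) 1))) 1))
       (\<lambda>R'' M''. P i (R''(1 := 1, 6 := int i)) M'') R' M'"
      apply (intro wp_intros)
      using 9(1,2) fr SM[of i] cM[of i] undo const_bounds
      by (auto simp: set_of_cells_indicates[OF ins] T_def split: if_splits intro: keep add)
    then show ?case by (rule wp_le) simp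
  next
    case (10 R' M')
    then obtain I where I: "I \<subseteq> {x \<in> T. 0 < x}" "indep I"
      "\<forall>x\<in>T - I. 0 < x \<longrightarrow> \<not> indep (insert x I)" "R' 9 = R 9 - int (card I)"
      unfolding P_def by blast
    moreover have "0 < x" if "x \<in> T" for x using that Sn by (auto simp: T_def)
    ultimately have "card I = rank T" by (intro maximal_card_eq_rank) auto
    then show ?case using I by simp
  qed (use const_bounds inp in \<open>auto simp: input_ok_def\<close>)
  then show ?thesis by (simp add: T_def)
qed

lemma wp_test_colours:
  assumes inp: "input_ok R M" and S: "indicates n (M (d + 5)) S"
  shows "wp (test_colours d K) (colour_test_time n K)
    (\<lambda>R' M'. R' 8 = (if (\<Sum>x\<in>{x \<in> {1..int K}. 0 < M (d + 4) x}. M (d + 3) x)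
        \<le> int (rank {x \<in> S. 0 < M (d + 4) (c x)}) then R 8 else 0)) R M"
  unfolding test_colours_def colour_test_time_def
proof (rule wp_Seq, rule wp_Const, simp, use const_bounds in simp,
    rule wp_Seq, rule wp_mono[OF wp_select_sum order.refl])
  fix R1 M1 assume *: "R1 9 = (\<Sum>x\<in>{x \<in> {1..int K}. 0 < M (d + 4) x}. M (d + 3) x) \<and> M1 = M"
    "\<And>r. r \<notin> wreg (select_sum 7 (d + 4) (d + 3)) \<Longrightarrow> R1 r = (R(7 := int K)) r"
  then have M1: "M1 = M" and R1: "R1 0 = R 0" "R1 8 = R 8" by auto
  show "wp (Const 3 0;; fill (d + 6) 3;; greedy d;; If 9 (Const 8 0) Skip)
     (1 + ((n * 4 + 3) + ((n * 14 + 3) + (1 + max 1 1))))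
     (\<lambda>R' M'. R' 8 = (if (\<Sum>x\<in>{x \<in> {1..int K}. 0 < M (d + 4) x}. M (d + 3) x)
        \<le> int (rank {x \<in> S. 0 < M (d + 4) (c x)}) then R 8 else 0)) R1 M1"
  proof (rule wp_Seq, rule wp_Const, simp, simp, rule wp_Seq, rule wp_mono[OF wp_fill order.refl])
    fix R2 M2
    assume **: "M2 (d + 6) = (\<lambda>x. if x \<in> {1..int n} then (R1(3 := 0)) 3 else M1 (d + 6) x)"
      "\<And>r. r \<notin> wreg (fill (d + 6) 3) \<Longrightarrow> R2 r = (R1(3 := 0)) r"
      "\<And>m. m \<notin> wmem (fill (d + 6) 3) \<Longrightarrow> M2 m = M1 m"
    have M2: "M2 (d + 4) = M (d + 4)" "M2 (d + 5) = M (d + 5)" and R2: "R2 8 = R 8" "R2 9 = R1 9"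
      using **(2,3) M1 R1 by auto
    have "input_ok R2 M2"
      by (rule input_ok_cong[OF inp]) (use **(2,3) R1 M1 in auto)
    moreover have "indicates n (M2 (d + 6)) {}" using **(1) by (simp add: indicates_def)
    ultimately show "wp (greedy d;; If 9 (Const 8 0) Skip) ((n * 14 + 3) + (1 + max 1 1))
       (\<lambda>R' M'. R' 8 = (if (\<Sum>x\<in>{x \<in> {1..int K}. 0 < M (d + 4) x}. M (d + 3) x)
          \<le> int (rank {x \<in> S. 0 < M (d + 4) (c x)}) then R 8 else 0)) R2 M2"
      by (intro wp_Seq wp_mono[OF wp_greedy[of R2 M2 S] order.refl] wp_If wp_Const wp_Skip)
         (use S M2 R2 * in auto)
  qed (use const_bounds inp R1 in \<open>auto simp: input_ok_def\<close>)
qed (use const_bounds in auto)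

text \<open>Every vector \<open>h\<close> names a colour set through its positive cells, so further
  members of \<open>V\<close> do no harm; it suffices that all 0/1 vectors occur. Outside the colour
  cells the enumeration never varies \<open>h\<close>, hence the fixed \<open>h0\<close>.\<close>

lemma quota_ok_iff_indicators:
  assumes S: "S \<subseteq> {1..n}"
    and V: "\<And>h :: int \<Rightarrow> int. (\<And>x. x \<in> {1..int K} \<Longrightarrow> h x \<in> {0..<2}) \<Longrightarrow> (\<And>x. x \<notin> {1..int K} \<Longrightarrow> h x = h0 x) \<Longrightarrow> h \<in> V"
  shows "quota_ok {1..int K} c l S \<longleftrightarrow>
    (\<forall>h\<in>V. (\<Sum>x\<in>{x \<in> {1..int K}. 0 < h x}. l x) \<le> int (rank {x \<in> S. 0 < h (c x)}))"
proof
  assume ok: "quota_ok {1..int K} c l S"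
  show "\<forall>h\<in>V. (\<Sum>x\<in>{x \<in> {1..int K}. 0 < h x}. l x) \<le> int (rank {x \<in> S. 0 < h (c x)})"
  proof
    fix h
    have eq: "{x \<in> S. 0 < h (c x)} = {x \<in> S. c x \<in> {x \<in> {1..int K}. 0 < h x}}"
      using S colour by (auto simp: subset_iff)
    show "(\<Sum>x\<in>{x \<in> {1..int K}. 0 < h x}. l x) \<le> int (rank {x \<in> S. 0 < h (c x)})"
      unfolding eq by (rule ok[unfolded quota_ok_def, rule_format]) auto
  qed
next
  assume all: "\<forall>h\<in>V. (\<Sum>x\<in>{x \<in> {1..int K}. 0 < h x}. l x) \<le> int (rank {x \<in> S. 0 < h (c x)})"
  show "quota_ok {1..int K} c l S"
    unfolding quota_ok_def
  proof (intro allI impI)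
    fix A assume A: "A \<subseteq> {1..int K}"
    define h where "h x = (if x \<in> {1..int K} then if x \<in> A then 1 else 0 else h0 x)" for x
    have "h \<in> V" by (rule V) (auto simp: h_def)
    moreover have "{x \<in> {1..int K}. 0 < h x} = A" using A by (auto simp: h_def split: if_splits)
    moreover have "{x \<in> S. 0 < h (c x)} = {x \<in> S. c x \<in> A}"
      using A S colour by (auto simp: h_def subset_iff split: if_splits)
    ultimately show "sum l A \<le> int (rank {x \<in> S. c x \<in> A})" using all by metis
  qed
qed

lemma wp_check_quota:
  assumes inp: "input_ok R M" and S: "indicates n (M (d + 5)) S"
  shows "wp (check_quota d K) (1 + (1 + enum_time 2 (colour_test_time n K) K))
    (\<lambda>R' M'. R' 8 = (if quota_ok {1..int K} c (M (d + 3)) S then 1 else 0)) R M"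
  unfolding check_quota_def
proof (rule wp_Seq, rule wp_Const, simp, use const_bounds in simp,
    rule wp_Seq, rule wp_Const, simp, use const_bounds in simp)
  let ?cond = "\<lambda>h. (\<Sum>x\<in>{x \<in> {1..int K}. 0 < h x}. M (d + 3) x) \<le> int (rank {x \<in> S. 0 < h (c x)})"
  show "wp (enum 20 (d + 4) 12 (test_colours d K) K) (enum_time 2 (colour_test_time n K) K)
     (\<lambda>R' M'. R' 8 = (if quota_ok {1..int K} c (M (d + 3)) S then 1 else 0)) (R(8 := 1, 12 := 2)) M"
  proof (rule wp_enum[where I = "\<lambda>V R' M'. R' 8 = (if \<forall>h\<in>V. ?cond h then 1 else 0)"], goal_cases)
    case (10 V R1 M1)
    have M1: "M1 k = M k" if "k \<noteq> d + 4" "k \<noteq> d + 6" for k using 10(3) that by auto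
    have "input_ok R1 M1" by (rule input_ok_cong[OF inp]) (use 10(2) M1 in auto)
    moreover have "indicates n (M1 (d + 5)) S" using S M1 by simp
    ultimately have "wp (test_colours d K) (colour_test_time n K)
      (\<lambda>R' M'. R' 8 = (if (\<Sum>x\<in>{x \<in> {1..int K}. 0 < M1 (d + 4) x}. M1 (d + 3) x)
        \<le> int (rank {x \<in> S. 0 < M1 (d + 4) (c x)}) then R1 8 else 0)) R1 M1"
      by (rule wp_test_colours)
    then show ?case
      by (rule wp_mono[OF _ order.refl]) (use 10(1) M1[of "d + 3"] in auto)
  next
    case (12 V R1 M1)
    have "quota_ok {1..int K} c (M (d + 3)) S \<longleftrightarrow> (\<forall>h\<in>V. ?cond h)"
      by (rule quota_ok_iff_indicators[where ?h0.0 = "M (d + 4)"]) (use S 12 in \<open>auto simp: indicates_def\<close>)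
    then show ?case using 12(1) by simp
  qed (use const_bounds in auto)
qed

abbreviation colour_card :: "nat set \<Rightarrow> int \<Rightarrow> int" where
  "colour_card S k \<equiv> int (card {x \<in> S. c x = k})"

text \<open>With \<open>i\<close> elements to go, \<open>{1..i}\<close> is still intact and every
  retained element above \<open>i\<close> has failed its deletion test. By
  \<open>quota_ok_mono\<close> these failures persist while \<open>S\<close> shrinks, so at
  \<open>i = 0\<close> the set is deletion-minimal and \<open>quota_minimal\<close> applies.\<close>

lemma wp_delete_all:
  assumes inp: "input_ok R M" and S: "indicates n (M (d + 5)) {1..n}"
    and nonneg: "\<And>k. k \<in> {1..int K} \<Longrightarrow> 0 \<le> M (d + 3) k"
  shows "wp (delete_all d K) (delete_time n K)
    (\<lambda>R' M'. \<exists>S. indicates n (M' (d + 5)) S \<and> (quota_ok {1..int K} c (M (d + 3)) {1..n} \<longrightarrow>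
       indep S \<and> (\<forall>k\<in>{1..int K}. colour_card S k = M (d + 3) k))) R M"
proof -
  let ?ok = "quota_ok {1..int K} c (M (d + 3))"
  let ?P = "\<lambda>i R' M'. \<exists>S. indicates n (M' (d + 5)) S \<and> {1..i} \<subseteq> S \<and>
    (?ok {1..n} \<longrightarrow> ?ok S) \<and> (\<forall>x\<in>S. i < x \<longrightarrow> \<not> ?ok (S - {x}))"
  let ?X = "{2, 3, 4, 5, 6, 7, 8, 9, 12} \<union> {20..<20 + K}" and ?Y = "{d + 4, d + 5, d + 6}"
  show ?thesis
    unfolding delete_all_def delete_time_def
  proof (rule wp_For[where X = "insert 1 ?X" and Y = ?Y and P = ?P], goal_cases)
    case 4
    then show ?case using frame_check_quota[of d K] by auto
  next
    case 5
    then show ?case using frame_check_quota[of d K] by auto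
  next
    case (9 i R' M')
    obtain S where S: "indicates n (M' (d + 5)) S" "{1..Suc i} \<subseteq> S" "?ok {1..n} \<longrightarrow> ?ok S"
      "\<forall>x\<in>S. Suc i < x \<longrightarrow> \<not> ?ok (S - {x})" using 9(3) by blast
    define R1 where "R1 = R'(2 := 0)"
    define M1 where "M1 = M'(d + 5 := (M' (d + 5))(1 + int i := 0))"
    have frM: "M' k = M k" if "k \<notin> ?Y" for k using 9(5)[OF that] .
    have R0: "R' 0 = R 0" by (rule 9(4)) auto
    have "input_ok R1 M1"
      by (rule input_ok_cong[OF inp]) (use R0 frM in \<open>auto simp: R1_def M1_def\<close>)
    moreover have ind: "indicates n (M1 (d + 5)) (S - {Suc i})"
      using S(1) by (auto simp: indicates_def M1_def)
    ultimately have check: "wp (check_quota d K) (1 + (1 + enum_time 2 (colour_test_time n K) K))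
       (\<lambda>R' M'. R' 8 = (if ?ok (S - {Suc i}) then 1 else 0)) R1 M1"
      using wp_check_quota[of R1 M1 "S - {Suc i}"] frM[of "d + 3"] by (simp add: M1_def)
    have "wp (Const 2 0;; Store (d + 5) 13 2;; check_quota d K;; If 8 Skip (Const 2 1;; Store (d + 5) 13 2))
       (1 + (1 + ((1 + (1 + enum_time 2 (colour_test_time n K) K)) + (1 + max 1 (1 + 1)))))
       (\<lambda>R'' M''. ?P i (R''(1 := 1, 13 := int i)) M'') R' M'"
    proof (intro wp_Seq wp_Const wp_Store)
      have "wp (check_quota d K) (1 + (1 + enum_time 2 (colour_test_time n K) K))
         (wp (If 8 Skip (Const 2 1;; Store (d + 5) 13 2)) (1 + max 1 (1 + 1))
            (\<lambda>R'' M''. ?P i (R''(1 := 1, 13 := int i)) M'')) R1 M1"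
      proof (rule wp_mono[OF check order.refl])
        fix R2 M2 assume 2: "R2 8 = (if ?ok (S - {Suc i}) then 1 else 0)"
          "\<And>r. r \<notin> wreg (check_quota d K) \<Longrightarrow> R2 r = R1 r" "\<And>m. m \<notin> wmem (check_quota d K) \<Longrightarrow> M2 m = M1 m"
        have M2: "M2 (d + 5) = M1 (d + 5)" by (rule 2(3)) (use frame_check_quota[of d K] in auto)
        have "13 \<notin> wreg (check_quota d K)" using frame_check_quota(1)[of d K] by auto
        then have R2: "R2 13 = 1 + int i" using 2(2)[of 13] 9(2) by (simp add: R1_def)
        have restore: "indicates n ((M2 (d + 5))(1 + int i := 1)) S"
          using S(1,2) ind 9(1) by (auto simp: indicates_def M2)
        show "wp (If 8 Skip (Const 2 1;; Store (d + 5) 13 2)) (1 + max 1 (1 + 1))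
            (\<lambda>R'' M''. ?P i (R''(1 := 1, 13 := int i)) M'') R2 M2"
        proof (intro wp_If wp_Skip wp_Seq wp_Const wp_Store)
          assume "0 < R2 8"
          then have ok: "?ok (S - {Suc i})" using 2(1) by (auto split: if_splits)
          have "\<not> ?ok (S - {Suc i} - {x})" if "x \<in> S - {Suc i}" "i < x" for x
          proof
            assume "?ok (S - {Suc i} - {x})"
            then have "?ok (S - {x})" by (rule quota_ok_mono) auto
            moreover have "x \<in> S" "Suc i < x" using that by (auto intro: Suc_lessI)
            ultimately show False using S(4) by blast
          qed
          moreover have "{1..i} \<subseteq> S - {Suc i}" using S(2) by auto
          ultimately show "?P i (R2(1 := 1, 13 := int i)) M2"
            using ind ok M2 by (intro exI[of _ "S - {Suc i}"]) auto
        next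
          assume "R2 8 \<le> 0"
          then have "\<not> ?ok (S - {Suc i})" using 2(1) by (auto split: if_splits)
          then have "\<forall>x\<in>S. i < x \<longrightarrow> \<not> ?ok (S - {x})" using S(4) by (metis Suc_lessI)
          then have "?P i (R2(2 := 1, 1 := 1, 13 := int i)) (M2(d + 5 := (M2 (d + 5))(1 + int i := 1)))"
            using restore S(2,3) by (intro exI[of _ S]) auto
          then show "?P i (R2(2 := 1, 1 := 1, 13 := int i))
              (M2(d + 5 := (M2 (d + 5))((R2(2 := 1)) 13 := (R2(2 := 1)) 2)))"
            using R2 by simp
        qed (use const_bounds in auto)
      qed
      then show "wp (check_quota d K) (1 + (1 + enum_time 2 (colour_test_time n K) K))
         (wp (If 8 Skip (Const 2 1;; Store (d + 5) 13 2)) (1 + max 1 (1 + 1))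
            (\<lambda>R'' M''. ?P i (R''(1 := 1, 13 := int i)) M''))
         (R'(2 := 0)) (M'(d + 5 := (M' (d + 5))((R'(2 := 0)) 13 := (R'(2 := 0)) 2)))"
        using 9(2) by (simp add: R1_def M1_def)
    qed auto
    then show ?case by (rule wp_le) simp
  next
    case (10 R' M')
    then obtain S where S: "indicates n (M' (d + 5)) S" "?ok {1..n} \<longrightarrow> ?ok S"
      "\<forall>x\<in>S. 0 < x \<longrightarrow> \<not> ?ok (S - {x})" by auto
    have Sn: "S \<subseteq> {1..n}" using S(1) by (simp add: indicates_def)
    have "indep S \<and> (\<forall>k\<in>{1..int K}. colour_card S k = M (d + 3) k)" if "?ok {1..n}"
    proof -
      have col: "c ` S \<subseteq> {1..int K}" using Sn colour by auto
      have fin: "finite {1..int K}" "finite S" using Sn finite_subset by auto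
      have min: "\<not> ?ok (S - {x})" if "x \<in> S" for x using S(3) Sn that by fastforce
      have ok: "?ok S" using S(2) that by blast
      show ?thesis using quota_minimal[OF fin col nonneg ok min] by blast
    qed
    then show ?case using S(1) by blast
  qed (use const_bounds inp S in \<open>auto simp: input_ok_def indicates_def\<close>)
qed

section \<open>Ranking candidates by size and objective value\<close>

definition best :: "nat set \<Rightarrow> regs \<Rightarrow> mems \<Rightarrow> bool" where
  "best B R M \<longleftrightarrow> indep B \<and> indicates n (M (d + 1)) B \<and> R 10 = int (card B) \<and>
     vec_of_cells d (M (d + 8)) = profile d w B"

lemma best_cong:
  "best B R M \<Longrightarrow> R' 10 = R 10 \<Longrightarrow> M' (d + 1) = M (d + 1) \<Longrightarrow> M' (d + 8) = M (d + 8) \<Longrightarrow> best B R' M'"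
  by (simp add: best_def)

text \<open>A lexicographic total preorder. Putting size first makes any independent set that
  dominates a base a base itself, without the rank being known.\<close>

definition dominates :: "nat set \<Rightarrow> nat set \<Rightarrow> bool" where
  "dominates B S \<longleftrightarrow> card S < card B \<or>
     card S = card B \<and> at_int f (profile d w B) \<le> at_int f (profile d w S)"

lemma dominates_refl: "dominates B B"
  by (simp add: dominates_def)

lemma dominates_trans: "dominates A B \<Longrightarrow> dominates B C \<Longrightarrow> dominates A C"
  by (auto simp: dominates_def)

lemma dominates_linear: "\<not> dominates A B \<Longrightarrow> dominates B A"
  by (auto simp: dominates_def)

lemma wp_evaluate:
  assumes inp: "input_ok R M" and S: "indicates n (M (d + 5)) S"
  shows "wp (evaluate d) (evaluate_time n d)
    (\<lambda>R' M'. R' 9 = int (card S) \<and> vec_of_cells d (M' (d + 7)) = profile d w S) R M"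
  unfolding evaluate_def evaluate_time_def
proof (rule wp_Seq, rule wp_unroll[where X = "{1, 2, 3, 6, 9}" and Y = "{d + 7}" and
      P = "\<lambda>i R' M'. \<forall>k\<in>{1..i}. M' (d + 7) (int k) = (\<Sum>x\<in>S. w k x)"], goal_cases)
  case (4 i R' M')
  have inp': "input_ok R' M'" by (rule input_ok_cong[OF inp]) (use 4(3,4) in auto)
  have S': "indicates n (M' (d + 5)) S" using S 4(4) by simp
  have Sn: "S \<subseteq> {1..n}" using S by (simp add: indicates_def)
  have sum: "(\<Sum>x\<in>{x \<in> {1..int n}. 0 < M' (d + 5) x}. M' (Suc i) x) = (\<Sum>x\<in>S. w (Suc i) x)"
    unfolding sum_selected_indicates[OF S']
    by (rule sum.cong) (use inp' Sn 4(1) in \<open>auto simp: input_ok_def\<close>)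
  show ?case
  proof (intro wp_Seq wp_mono[OF wp_select_sum[where m = n] order.refl] wp_Const wp_Store)
    fix R1 :: regs and M1 :: mems
    have eq: "int k = 1 + int i \<longleftrightarrow> k = Suc i" for k by auto
    assume 1: "R1 9 = (\<Sum>x\<in>{x \<in> {1..int n}. 0 < M' (d + 5) x}. M' (Suc i) x) \<and> M1 = M'"
    show "\<forall>k\<in>{1..Suc i}. (M1(d + 7 := (M1 (d + 7))((R1(2 := int (Suc i))) 2 := (R1(2 := int (Suc i))) 9)))
        (d + 7) (int k) = (\<Sum>x\<in>S. w k x)"
      using 1 4(2) sum by (auto simp: le_Suc_eq eq)
  qed (use const_bounds 4(1) inp' in \<open>auto simp: input_ok_def\<close>)
next
  case (5 R' M')
  have inp': "input_ok R' M'" by (rule input_ok_cong[OF inp]) (use 5(2,3) in auto)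
  have S': "indicates n (M' (d + 5)) S" using S 5(3) by simp
  have "(\<Sum>x\<in>S. M' (d + 5) (int x)) = (\<Sum>x\<in>S. 1)"
    using S' by (intro sum.cong) (auto simp: indicates_def)
  then have "(\<Sum>x\<in>{x \<in> {1..int n}. 0 < M' (d + 5) x}. M' (d + 5) x) = int (card S)"
    unfolding sum_selected_indicates[OF S'] by simp
  moreover have "vec_of_cells d (M' (d + 7)) = profile d w S"
    using 5(1) by (auto simp: vec_of_cells_def profile_def)
  ultimately show ?case
    by (intro wp_mono[OF wp_select_sum[where m = n] order.refl])
       (use const_bounds inp' in \<open>auto simp: input_ok_def\<close>)
qed auto

lemma vec_of_cells_copy:
  "vec_of_cells d (\<lambda>x. if x \<in> {1..int d} then A x else B x) = vec_of_cells d A"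
  by (auto simp: vec_of_cells_def)

lemma wp_save_best:
  assumes inp: "input_ok R M" and S: "indicates n (M (d + 5)) S" "indep S" "R 9 = int (card S)"
    "vec_of_cells d (M (d + 7)) = profile d w S"
  shows "wp (save_best d) (save_time n d) (best S) R M"
  unfolding save_best_def save_time_def
proof (rule wp_Seq, rule wp_Const, simp, simp, rule wp_Seq, rule wp_Add,
    rule wp_Seq, rule wp_mono[OF wp_copy_cells[where m = n] order.refl])
  fix R1 M1
  let ?R = "R(4 := 0, 10 := (R(4 := 0)) 9 + (R(4 := 0)) 4)"
  assume 1: "M1 (d + 1) = (\<lambda>x. if x \<in> {1..int n} then M (d + 5) x else M (d + 1) x)"
    "\<And>r. r \<notin> wreg (copy_cells 0 (d + 5) (d + 1)) \<Longrightarrow> R1 r = ?R r"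
    "\<And>m. m \<notin> wmem (copy_cells 0 (d + 5) (d + 1)) \<Longrightarrow> M1 m = M m"
  have ind: "indicates n (M1 (d + 1)) S" using S(1) unfolding 1(1) by (auto simp: indicates_def)
  have R1: "R1 10 = int (card S)" and M1: "M1 (d + 7) = M (d + 7)" using 1(2,3) S(3) by auto
  show "wp (Const 5 (int d);; copy_cells 5 (d + 7) (d + 8)) (1 + (d * 5 + 3)) (best S) R1 M1"
  proof (rule wp_Seq, rule wp_Const, simp, use const_bounds in simp,
      rule wp_mono[OF wp_copy_cells[where m = d] order.refl])
    fix R2 M2
    assume 2: "M2 (d + 8) = (\<lambda>x. if x \<in> {1..int d} then M1 (d + 7) x else M1 (d + 8) x)"
      "\<And>r. r \<notin> wreg (copy_cells 5 (d + 7) (d + 8)) \<Longrightarrow> R2 r = (R1(5 := int d)) r"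
      "\<And>m. m \<notin> wmem (copy_cells 5 (d + 7) (d + 8)) \<Longrightarrow> M2 m = M1 m"
    show "best S R2 M2"
      using S(2,4) ind R1 M1 2(2)[of 10] 2(3)[of "d + 1"]
      by (simp add: best_def 2(1) vec_of_cells_copy del: atLeastAtMost_iff)
  qed (use const_bounds in auto)
qed (use const_bounds inp in \<open>auto simp: input_ok_def\<close>)

lemma wp_compare:
  assumes inp: "input_ok R M" and S: "indicates n (M (d + 5)) S" and B: "best B R M"
  shows "wp (compare d) (compare_time n d)
    (\<lambda>R' M'. \<exists>B'. best B' R' M' \<and> dominates B' B \<and> (indep S \<longrightarrow> dominates B' S)) R M"
  unfolding compare_def compare_time_def
proof (rule wp_Seq, rule wp_Query_Indep, rule wp_If, goal_cases)
  case 2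
  have "best B (R(2 := if indep (set_of_cells n (M (d + 5))) then 1 else 0)) M"
    by (rule best_cong[OF B]) auto
  then show ?case
    using 2 set_of_cells_indicates[OF S] by (intro wp_Skip) (auto simp: dominates_refl)
next
  case 1
  let ?Q = "\<lambda>R' M'. \<exists>B'. best B' R' M' \<and> dominates B' B \<and> (indep S \<longrightarrow> dominates B' S)"
  let ?R = "R(2 := if indep (set_of_cells n (M (d + 5))) then 1 else 0)"
  have indep: "indep S" using 1 set_of_cells_indicates[OF S] by (auto split: if_splits)
  have "input_ok ?R M" by (rule input_ok_cong[OF inp]) auto
  from wp_evaluate[OF this S] show ?case
  proof (rule wp_Seq[OF wp_mono[OF _ order.refl]])
    fix R1 M1
    assume 1: "R1 9 = int (card S) \<and> vec_of_cells d (M1 (d + 7)) = profile d w S"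
      "\<And>r. r \<notin> wreg (evaluate d) \<Longrightarrow> R1 r = ?R r" "\<And>m. m \<notin> wmem (evaluate d) \<Longrightarrow> M1 m = M m"
    have frR: "R1 r = R r" if "r \<notin> {1, 2, 3, 6, 9}" for r
      using 1(2)[of r] frame_evaluate(1)[of d] that by auto
    have frM: "M1 m = M m" if "m \<noteq> d + 7" for m
      using 1(3)[of m] frame_evaluate(2)[of d] that by auto
    \<comment> \<open>The branches above only decide the flag in register \<open>3\<close>, so one
      statement about the final update serves all of them.\<close>
    have fin: "wp (If 3 (save_best d) Skip) (1 + max (save_time n d) 1) ?Q R2 M1"
      if same: "\<And>r. r \<notin> {2, 3, 4} \<Longrightarrow> R2 r = R1 r" and better: "0 < R2 3 \<longleftrightarrow> dominates S B" for R2
    proof (rule wp_If)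
      assume "0 < R2 3"
      then have dom: "dominates S B" using better by simp
      have inp2: "input_ok R2 M1" by (rule input_ok_cong[OF inp]) (use same frR frM in auto)
      have S2: "indicates n (M1 (d + 5)) S" "R2 9 = int (card S)" using S frM same 1(1) by auto
      show "wp (save_best d) (save_time n d) ?Q R2 M1"
        by (rule wp_mono[OF wp_save_best[OF inp2 S2(1) indep S2(2)] order.refl])
           (use 1(1) dom dominates_refl in auto)
    next
      assume "R2 3 \<le> 0"
      then have "dominates B S" using better dominates_linear by auto
      moreover have "best B R2 M1" by (rule best_cong[OF B]) (use same frR frM in auto)
      ultimately show "wp Skip 1 ?Q R2 M1" using dominates_refl by (intro wp_Skip) blast
    qed
    have R10: "R1 10 = int (card B)" using B frR[of 10] by (simp add: best_def)
    have vec: "vec_of_cells d (M1 (d + 8)) = profile d w B" using B frM[of "d + 8"] by (simp add: best_def)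
    show "wp (Sub 2 9 10;; If 2 (Const 3 1)
        (Const 4 1;; Add 2 2 4;; If 2 (Query_Le 3 (d + 7) (d + 8)) (Const 3 0));;
      If 3 (save_best d) Skip) (1 + ((1 + max 1 (1 + (1 + (1 + max 1 1)))) + (1 + max (save_time n d) 1))) ?Q R1 M1"
      by (intro wp_Seq wp_Sub wp_If[of _ 2] wp_Const wp_Add wp_Query_Le fin)
         (use 1(1) R10 vec const_bounds in \<open>auto simp: dominates_def\<close>)
  qed
qed

lemma wp_try_quota:
  assumes inp: "input_ok R M" and B: "best B R M"
    and nonneg: "\<And>k. k \<in> {1..int K} \<Longrightarrow> 0 \<le> M (d + 3) k"
  shows "wp (try_quota d K) (try_time n d K)
    (\<lambda>R' M'. \<exists>B'. best B' R' M' \<and> dominates B' B \<and> (quota_ok {1..int K} c (M (d + 3)) {1..n} \<longrightarrow>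
       (\<exists>S. indep S \<and> (\<forall>k\<in>{1..int K}. colour_card S k = M (d + 3) k) \<and> dominates B' S))) R M"
  unfolding try_quota_def try_time_def
proof (rule wp_Seq, rule wp_Const, simp, use const_bounds in simp,
    rule wp_Seq, rule wp_mono[OF wp_fill order.refl])
  let ?Q = "\<lambda>R' M'. \<exists>B'. best B' R' M' \<and> dominates B' B \<and> (quota_ok {1..int K} c (M (d + 3)) {1..n} \<longrightarrow>
       (\<exists>S. indep S \<and> (\<forall>k\<in>{1..int K}. colour_card S k = M (d + 3) k) \<and> dominates B' S))"
  fix R1 M1
  assume 1: "M1 (d + 5) = (\<lambda>x. if x \<in> {1..int n} then (R(2 := 1)) 2 else M (d + 5) x)"
    "\<And>r. r \<notin> wreg (fill (d + 5) 2) \<Longrightarrow> R1 r = (R(2 := 1)) r"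
    "\<And>m. m \<notin> wmem (fill (d + 5) 2) \<Longrightarrow> M1 m = M m"
  have inp1: "input_ok R1 M1" by (rule input_ok_cong[OF inp]) (use 1 in auto)
  have all: "indicates n (M1 (d + 5)) {1..n}" by (auto simp: 1(1) indicates_def)
  have quota: "M1 (d + 3) = M (d + 3)" using 1(3) by simp
  have "wp (delete_all d K) (delete_time n K)
    (\<lambda>R' M'. \<exists>S. indicates n (M' (d + 5)) S \<and> (quota_ok {1..int K} c (M (d + 3)) {1..n} \<longrightarrow>
       indep S \<and> (\<forall>k\<in>{1..int K}. colour_card S k = M (d + 3) k))) R1 M1"
    using wp_delete_all[OF inp1 all] nonneg unfolding quota by simp
  then show "wp (delete_all d K;; compare d) (delete_time n K + compare_time n d) ?Q R1 M1"
  proof (rule wp_Seq[OF wp_mono[OF _ order.refl]])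
    fix R2 M2
    assume 2: "\<exists>S. indicates n (M2 (d + 5)) S \<and> (quota_ok {1..int K} c (M (d + 3)) {1..n} \<longrightarrow>
       indep S \<and> (\<forall>k\<in>{1..int K}. colour_card S k = M (d + 3) k))"
      "\<And>r. r \<notin> wreg (delete_all d K) \<Longrightarrow> R2 r = R1 r" "\<And>m. m \<notin> wmem (delete_all d K) \<Longrightarrow> M2 m = M1 m"
    then obtain S where S: "indicates n (M2 (d + 5)) S" "quota_ok {1..int K} c (M (d + 3)) {1..n} \<longrightarrow>
       indep S \<and> (\<forall>k\<in>{1..int K}. colour_card S k = M (d + 3) k)" by blast
    have frR: "R2 r = R1 r" if "r \<notin> {1, 2, 3, 4, 5, 6, 7, 8, 9, 12, 13} \<union> {20..<20 + K}" for r
      by (rule 2(2)) (use frame_delete_all(1)[of d K] that in blast)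
    have frM: "M2 m = M1 m" if "m \<notin> {d + 4, d + 5, d + 6}" for m
      by (rule 2(3)) (use frame_delete_all(2)[of d K] that in blast)
    have inp2: "input_ok R2 M2" by (rule input_ok_cong[OF inp1]) (use frR frM in auto)
    have B2: "best B R2 M2" by (rule best_cong[OF B]) (use 1(2,3) frR frM in auto)
    show "wp (compare d) (compare_time n d) ?Q R2 M2"
      by (rule wp_mono[OF wp_compare[OF inp2 S(1) B2] order.refl]) (use S(2) in blast)
  qed
qed (use const_bounds inp in \<open>auto simp: input_ok_def\<close>)

section \<open>Reduction of optimality to colour counts\<close>

lemma sum_by_colour:
  assumes "S \<subseteq> {1..n}" "i \<in> {1..d}"
  shows "(\<Sum>x\<in>S. w i x) = (\<Sum>k\<in>{1..int K}. colour_card S k * wt i k)"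
proof -
  have fin: "finite S" using assms finite_subset by blast
  have "(\<Sum>x\<in>S. w i x) = (\<Sum>k\<in>{1..int K}. \<Sum>x\<in>{x \<in> S. c x = k}. w i x)"
    by (rule sum.group[symmetric]) (use fin assms colour in auto)
  also have "\<dots> = (\<Sum>k\<in>{1..int K}. \<Sum>x\<in>{x \<in> S. c x = k}. wt i k)"
    by (intro sum.cong refl) (use weight assms in auto)
  finally show ?thesis by simp
qed

lemma card_by_colour:
  assumes "S \<subseteq> {1..n}"
  shows "int (card S) = (\<Sum>k\<in>{1..int K}. colour_card S k)"
proof -
  have fin: "finite S" using assms finite_subset by blast
  have "(\<Sum>k\<in>{1..int K}. \<Sum>x\<in>{x \<in> S. c x = k}. 1 :: int) = (\<Sum>x\<in>S. 1)"
    by (rule sum.group) (use fin assms colour in auto)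
  then show ?thesis by simp
qed

text \<open>Colour counts determine both size and profile. Hence one representative per quota vector
  stands for all sets with these counts.\<close>

lemma dominates_cong_colour:
  assumes "S \<subseteq> {1..n}" "T \<subseteq> {1..n}" "\<forall>k\<in>{1..int K}. colour_card S k = colour_card T k"
  shows "dominates B S \<longleftrightarrow> dominates B T"
proof -
  have "int (card S) = int (card T)"
    unfolding card_by_colour[OF assms(1)] card_by_colour[OF assms(2)] using assms(3) by simp
  moreover have "profile d w S = profile d w T"
    unfolding profile_def
    by (rule map_cong) (use sum_by_colour[OF assms(1)] sum_by_colour[OF assms(2)] assms(3) in auto)
  ultimately show ?thesis by (simp add: dominates_def)
qed

text \<open>Dominating one base forces \<open>B\<close> up to full rank; against every base the
  sizes are then tied, and only the comparison of \<open>f\<close> is left.\<close>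

lemma optimal_base_if_dominates:
  assumes B: "indep B" and dom: "\<And>T. is_base indep T \<Longrightarrow> dominates B T"
  shows "optimal_base indep d w f B"
proof -
  obtain T where T: "indep T" "T \<subseteq> {1..n}" "card T = rank {1..n}" by (rule rank_attained)
  then have "dominates B T" using dom is_base_iff_card_eq_rank by blast
  then have "card B = rank {1..n}"
    using T(3) card_le_rank[OF B indep_subset_ground[OF B]] by (auto simp: dominates_def)
  then show ?thesis
    using B dom unfolding optimal_base_def is_base_iff_card_eq_rank by (auto simp: dominates_def)
qed

text \<open>The invariant asks that the best set dominate one representative of each feasible quota
  vector visited; transitivity preserves this when the best set is replaced. The colour counts of
  any base \<open>T\<close> form such a vector, feasible because of \<open>T\<close> itself, and its
  representative ranks like \<open>T\<close>.\<close>

lemma wp_search: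
  assumes inp: "input_ok R M" and B: "best B R M"
  shows "wp (search d K) (1 + (1 + enum_time (n + 1) (try_time n d K) K))
    (\<lambda>R' M'. optimal_base indep d w f (set_of_cells n (M' (d + 1)))) R M"
  unfolding search_def
proof (rule wp_Seq, rule wp_Const, simp, use const_bounds in simp, rule wp_Seq, rule wp_Add)
  let ?R = "R(2 := 1, 11 := (R(2 := 1)) 0 + (R(2 := 1)) 2)"
  let ?I = "\<lambda>V R' M'. \<exists>B. best B R' M' \<and> (\<forall>h\<in>V. quota_ok {1..int K} c h {1..n} \<longrightarrow>
     (\<exists>S. indep S \<and> (\<forall>k\<in>{1..int K}. colour_card S k = h k) \<and> dominates B S))"
  show "wp (enum (20 + K) (d + 3) 11 (try_quota d K) K) (enum_time (n + 1) (try_time n d K) K)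
     (\<lambda>R' M'. optimal_base indep d w f (set_of_cells n (M' (d + 1)))) ?R M"
  proof (rule wp_enum[where I = ?I], goal_cases)
    case 3
    then show ?case using inp by (simp add: input_ok_def)
  next
    case 4
    then show ?case using frame_try_quota(1)[of d K] by auto
  next
    case (7 i)
    then show ?case using frame_try_quota(1)[of d K] by auto
  next
    case 8
    then show ?case using frame_try_quota(2)[of d K] by auto
  next
    case (9 V R1 M1 R2 M2)
    then obtain B where B: "best B R1 M1" "\<forall>h\<in>V. quota_ok {1..int K} c h {1..n} \<longrightarrow>
      (\<exists>S. indep S \<and> (\<forall>k\<in>{1..int K}. colour_card S k = h k) \<and> dominates B S)" by blast
    have "best B R2 M2" by (rule best_cong[OF B(1)]) (use 9(2,3) in auto)
    then show ?case using B(2) by blast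
  next
    case (10 V R1 M1)
    then obtain B where B: "best B R1 M1" "\<forall>h\<in>V. quota_ok {1..int K} c h {1..n} \<longrightarrow>
      (\<exists>S. indep S \<and> (\<forall>k\<in>{1..int K}. colour_card S k = h k) \<and> dominates B S)" by blast
    have "0 \<notin> wreg (try_quota d K)" using frame_try_quota(1)[of d K] by auto
    then have frR: "R1 0 = R 0" using 10(2)[of 0] by simp
    have frM: "M1 k = M k" if "k \<le> d \<or> k = d + 2" for k
      by (rule 10(3)) (use frame_try_quota(2)[of d K] that in auto)
    have inp1: "input_ok R1 M1" by (rule input_ok_cong[OF inp]) (use frR frM in auto)
    have nonneg: "0 \<le> M1 (d + 3) k" if "k \<in> {1..int K}" for k using 10(4)[OF that] by auto
    show ?case
    proof (rule wp_mono[OF wp_try_quota[OF inp1 B(1) nonneg] order.refl])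
      fix R2 M2
      assume "\<exists>B'. best B' R2 M2 \<and> dominates B' B \<and> (quota_ok {1..int K} c (M1 (d + 3)) {1..n} \<longrightarrow>
        (\<exists>S. indep S \<and> (\<forall>k\<in>{1..int K}. colour_card S k = M1 (d + 3) k) \<and> dominates B' S))"
      then show "?I (insert (M1 (d + 3)) V) R2 M2" using B(2) dominates_trans by (smt (verit) insert_iff)
    qed
  next
    case 11
    have "best B ?R M" by (rule best_cong[OF B]) auto
    then show ?case by blast
  next
    case (12 V R1 M1)
    then obtain B where B: "best B R1 M1" "\<forall>h\<in>V. quota_ok {1..int K} c h {1..n} \<longrightarrow>
      (\<exists>S. indep S \<and> (\<forall>k\<in>{1..int K}. colour_card S k = h k) \<and> dominates B S)" by blast
    have "dominates B T" if "is_base indep T" for T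
    proof -
      have T: "indep T" "T \<subseteq> {1..n}" using that indep_subset_ground by (auto simp: is_base_def)
      \<comment> \<open>Outside the colour cells \<open>h\<close> has to agree with the initial
        memory, which the enumeration leaves alone there.\<close>
      define h where "h k = (if k \<in> {1..int K} then colour_card T k else M (d + 3) k)" for k
      have "h \<in> V"
      proof (rule 12(2))
        fix k assume k: "k \<in> {1..int K}"
        have "card {x \<in> T. c x = k} \<le> card {1..n}" using T(2) by (intro card_mono) auto
        then show "h k \<in> {0..<int (n + 1)}" using k by (simp add: h_def)
      next
        fix k assume "k \<notin> {1..int K}"
        then show "h k = M (d + 3) k" by (simp only: h_def if_False)
      qed
      moreover have "quota_ok {1..int K} c h {1..n}"
        by (rule quota_ok_of_indep[OF _ T]) (auto simp: h_def)
      ultimately obtain S where S: "indep S" "\<forall>k\<in>{1..int K}. colour_card S k = h k" "dominates B S"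
        using B(2) by blast
      have "\<forall>k\<in>{1..int K}. colour_card S k = colour_card T k" using S(2) by (simp add: h_def)
      then show ?thesis
        using S(3) dominates_cong_colour[OF indep_subset_ground[OF S(1)] T(2)] by blast
    qed
    moreover have "set_of_cells n (M1 (d + 1)) = B" "indep B"
      using B(1) set_of_cells_indicates by (auto simp: best_def)
    ultimately show ?case using optimal_base_if_dominates by simp
  qed (use const_bounds in auto)
qed

end

section \<open>Numbering colours by tuples of indices\<close>

definition tuple :: "nat \<Rightarrow> nat \<Rightarrow> nat \<Rightarrow> nat \<Rightarrow> nat" where
  "tuple d p m k = List.n_lists d [1..<Suc p] ! (m - 1) ! (k - 1)"

lemma length_tuples: "length (List.n_lists d [1..<Suc p]) = p ^ d"
  by (simp add: length_n_lists del: upt_Suc)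

lemma ex_tuple:
  assumes "\<forall>k\<in>{1..d}. g k \<in> {1..p}"
  obtains m where "m \<in> {1..p ^ d}" "\<forall>k\<in>{1..d}. tuple d p m k = g k"
proof -
  let ?xs = "map g [1..<Suc d]"
  have "set ?xs \<subseteq> set [1..<Suc p]"
    using assms by (auto simp: less_Suc_eq_le simp del: upt_Suc)
  then have "?xs \<in> set (List.n_lists d [1..<Suc p])"
    by (simp add: set_n_lists del: upt_Suc)
  then obtain i where i: "i < p ^ d" "List.n_lists d [1..<Suc p] ! i = ?xs"
    by (metis in_set_conv_nth length_tuples)
  \<comment> \<open>List positions start at 0 and colour numbers at 1, hence \<open>Suc i\<close>
    below.\<close>
  show thesis
    by (rule that[of "Suc i"]) (use i in \<open>auto simp: tuple_def simp del: upt_Suc\<close>)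
qed

lemma tuple_in:
  assumes "m \<in> {1..p ^ d}" "k \<in> {1..d}"
  shows "tuple d p m k \<in> {1..p}"
proof -
  let ?ys = "List.n_lists d [1..<Suc p] ! (m - 1)"
  have "?ys \<in> set (List.n_lists d [1..<Suc p])"
    using assms(1) by (intro nth_mem) (simp only: length_tuples atLeastAtMost_iff, linarith)
  then have ys: "length ?ys = d" "set ?ys \<subseteq> {1..p}"
    by (auto simp: set_n_lists less_Suc_eq_le simp del: upt_Suc)
  have "?ys ! (k - 1) \<in> set ?ys" using assms(2) ys(1) by (intro nth_mem) auto
  then show ?thesis using ys(2) unfolding tuple_def by blast
qed

text \<open>As only positivity can be tested, equality of a weight with the chosen value is checked
  by subtracting in both directions. The tuples are not stored; their entries are constants of the
  program.\<close>

definition match_colour :: "nat \<Rightarrow> nat \<Rightarrow> nat \<Rightarrow> com" where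
  "match_colour d p m = Const 2 1;;
     unroll (\<lambda>k. Load 3 k 6;; Const 4 (int (tuple d p m k));; Load 5 0 4;;
       Sub 4 3 5;; If 4 (Const 2 0) Skip;; Sub 4 5 3;; If 4 (Const 2 0) Skip) d;;
     If 2 (Const 3 (int m);; Store (d + 2) 6 3) Skip"

text \<open>If values coincide, several tuples fit an element and the last one is kept; any of them
  determines the weights.\<close>

definition assign_colours :: "nat \<Rightarrow> nat \<Rightarrow> com" where
  "assign_colours d p = For 6 0 (unroll (match_colour d p) (p ^ d))"

lemma frame_match_colour: "wreg (match_colour d p m) \<subseteq> {2, 3, 4, 5}" "wmem (match_colour d p m) \<subseteq> {d + 2}"
proof -
  let ?c = "\<lambda>k. Load 3 k 6;; Const 4 (int (tuple d p m k));; Load 5 0 4;;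
       Sub 4 3 5;; If 4 (Const 2 0) Skip;; Sub 4 5 3;; If 4 (Const 2 0) Skip"
  have "wreg (unroll ?c d) \<subseteq> {2, 3, 4, 5}" "wmem (unroll ?c d) \<subseteq> {}"
    by (rule wreg_unroll wmem_unroll; simp)+
  then show "wreg (match_colour d p m) \<subseteq> {2, 3, 4, 5}" "wmem (match_colour d p m) \<subseteq> {d + 2}"
    by (auto simp: match_colour_def)
qed

lemma frame_assign_colours:
  "wreg (assign_colours d p) \<subseteq> {1, 2, 3, 4, 5, 6}" "wmem (assign_colours d p) \<subseteq> {d + 2}"
proof -
  have "wreg (unroll (match_colour d p) (p ^ d)) \<subseteq> {2, 3, 4, 5}"
    "wmem (unroll (match_colour d p) (p ^ d)) \<subseteq> {d + 2}"
    by (rule wreg_unroll wmem_unroll, rule frame_match_colour)+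
  then show "wreg (assign_colours d p) \<subseteq> {1, 2, 3, 4, 5, 6}" "wmem (assign_colours d p) \<subseteq> {d + 2}"
    by (auto simp: assign_colours_def)
qed

context machine
begin

lemma wp_match_colour:
  assumes \<beta>: "1 \<le> \<beta>" "p \<le> \<beta>" "m \<le> \<beta>" and m: "m \<in> {1..p ^ d}"
  shows "wp (match_colour d p m) (match_time d)
    (\<lambda>R' M'. M' (d + 2) = (if \<forall>k\<in>{1..d}. M k (R 6) = M 0 (int (tuple d p m k))
       then (M (d + 2))(R 6 := int m) else M (d + 2))) R M"
  unfolding match_colour_def match_time_def
proof (rule wp_Seq, rule wp_Const, simp, use \<beta> in simp,
    rule wp_Seq, rule wp_unroll[where X = "{2, 3, 4, 5}" and Y = "{}" and
      P = "\<lambda>i R' M'. R' 2 = (if \<forall>k\<in>{1..i}. M k (R 6) = M 0 (int (tuple d p m k)) then 1 else 0)"], goal_cases)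
  case (4 i R' M')
  have 6: "R' 6 = R 6" using 4(3) by simp
  have tup: "tuple d p m (Suc i) \<le> \<beta>" using tuple_in[OF m, of "Suc i"] 4(1) \<beta> by auto
  have all: "(\<forall>k\<in>{1..Suc i}. M k (R 6) = M 0 (int (tuple d p m k))) \<longleftrightarrow>
     (\<forall>k\<in>{1..i}. M k (R 6) = M 0 (int (tuple d p m k))) \<and> M (Suc i) (R 6) = M 0 (int (tuple d p m (Suc i)))"
    by (auto simp: le_Suc_eq)
  show ?case unfolding all
    by (intro wp_intros) (use 4(2,4) 6 tup in auto)
next
  case (5 R' M')
  have "M' = M" using 5(3) by auto
  then show ?case
    by (intro wp_intros) (use 5(1,2) \<beta> in \<open>auto split: if_splits\<close>)
qed auto

lemma wp_assign_colours:
  assumes \<beta>: "1 \<le> \<beta>" "p \<le> \<beta>" "p ^ d \<le> \<beta>" and n: "R 0 = int n"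
    and a: "\<forall>i\<in>{1..p}. M 0 (int i) = a i" and w: "\<forall>k\<in>{1..d}. \<forall>x\<in>{1..n}. M k (int x) = w k x"
    and wa: "\<forall>k\<in>{1..d}. \<forall>x\<in>{1..n}. w k x \<in> a ` {1..p}"
  shows "wp (assign_colours d p) (n * ((p ^ d * match_time d + 1) + 3) + 3)
    (\<lambda>R' M'. \<forall>x\<in>{1..n}. \<exists>m\<in>{1..p ^ d}. M' (d + 2) (int x) = int m \<and>
       (\<forall>k\<in>{1..d}. w k x = a (tuple d p m k))) R M"
proof -
  define good where "good x m \<longleftrightarrow> (\<forall>k\<in>{1..d}. w k x = a (tuple d p m k))" for x m
  have ex_good: "\<exists>m\<in>{1..p ^ d}. good x m" if x: "x \<in> {1..n}" for x
  proof -
    have "\<forall>k\<in>{1..d}. \<exists>i\<in>{1..p}. w k x = a i" using wa x by blast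
    then obtain g where g: "\<forall>k\<in>{1..d}. g k \<in> {1..p} \<and> w k x = a (g k)" by metis
    then obtain m where m: "m \<in> {1..p ^ d}" "\<forall>k\<in>{1..d}. tuple d p m k = g k"
      using ex_tuple[of d g p] by metis
    have "good x m" using m(2) g by (simp add: good_def)
    then show ?thesis using m(1) by blast
  qed
  let ?Q = "\<lambda>M' x. \<exists>m\<in>{1..p ^ d}. M' (d + 2) (int x) = int m \<and> good x m"
  have "wp (assign_colours d p) (n * ((p ^ d * match_time d + 1) + 3) + 3)
    (\<lambda>R' M'. \<forall>x\<in>{1..n}. ?Q M' x) R M"
    unfolding assign_colours_def
  proof (rule wp_For[where X = "{2, 3, 4, 5}" and Y = "{d + 2}" and
        P = "\<lambda>i R' M'. \<forall>x\<in>{1..n}. i < x \<longrightarrow> ?Q M' x"], goal_cases)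
    case 4
    show ?case by (rule wreg_unroll) (rule frame_match_colour)
  next
    case 5
    show ?case by (rule wmem_unroll) (rule frame_match_colour)
  next
    case (9 i R' M')
    have R6: "R' 6 = int (Suc i)" by (rule 9(2))
    have frM: "M' k = M k" if "k \<noteq> d + 2" for k using 9(5) that by auto
    show ?case
    \<comment> \<open>Nothing is known about the cell of the current element until a fitting tuple
      has been met, hence the implication in the invariant. Elements done earlier keep their
      colours.\<close>
    proof (rule wp_unroll[where X = "{2, 3, 4, 5}" and Y = "{d + 2}" and
          P = "\<lambda>j R'' M''. (\<forall>x\<in>{1..n}. Suc i < x \<longrightarrow> ?Q M'' x) \<and>
             ((\<exists>m\<in>{1..j}. good (Suc i) m) \<longrightarrow> ?Q M'' (Suc i))"], goal_cases)
      case (1 j)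
      show ?case by (rule frame_match_colour)
    next
      case (2 j)
      show ?case by (rule frame_match_colour)
    next
      case 3
      then show ?case using 9(3) by auto
    next
      case (4 j R1 M1)
      have m: "Suc j \<in> {1..p ^ d}" using 4(1) by auto
      have R1: "R1 6 = int (Suc i)" using 4(3)[of 6] R6 by simp
      have M1: "M1 k = M k" if "k \<noteq> d + 2" for k using 4(4)[of k] frM[OF that] that by auto
      have good: "(\<forall>k\<in>{1..d}. M1 k (R1 6) = M1 0 (int (tuple d p (Suc j) k))) \<longleftrightarrow> good (Suc i) (Suc j)"
        unfolding good_def R1
      proof (intro ball_cong refl)
        fix k assume k: "k \<in> {1..d}"
        have "M1 k (int (Suc i)) = w k (Suc i)"
          using M1[of k] w[rule_format, OF k, of "Suc i"] k 9(1) by auto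
        moreover have "M1 0 (int (tuple d p (Suc j) k)) = a (tuple d p (Suc j) k)"
          using M1[of 0] a tuple_in[OF m k] by auto
        ultimately show "(M1 k (int (Suc i)) = M1 0 (int (tuple d p (Suc j) k))) \<longleftrightarrow>
           (w k (Suc i) = a (tuple d p (Suc j) k))" by simp
      qed
      have "wp (match_colour d p (Suc j)) (match_time d)
        (\<lambda>R' M'. M' (d + 2) = (if good (Suc i) (Suc j) then (M1 (d + 2))(int (Suc i) := int (Suc j)) else M1 (d + 2))) R1 M1"
        unfolding good[symmetric] R1[symmetric]
        by (rule wp_match_colour[OF \<beta>(1,2) _ m]) (use 4(1) \<beta>(3) in simp)
      then show ?case
      proof (rule wp_mono[OF _ order.refl])
        fix R2 M2
        assume M2: "M2 (d + 2) = (if good (Suc i) (Suc j) then (M1 (d + 2))(int (Suc i) := int (Suc j)) else M1 (d + 2))"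
        have "?Q M2 x" if "x \<in> {1..n}" "Suc i < x" for x
        proof -
          have eq: "M2 (d + 2) (int x) = M1 (d + 2) (int x)" unfolding M2 using that by auto
          show ?thesis unfolding eq using 4(2) that by blast
        qed
        moreover have "?Q M2 (Suc i)" if "\<exists>m\<in>{1..Suc j}. good (Suc i) m"
        proof (cases "good (Suc i) (Suc j)")
          case True
          then show ?thesis unfolding M2 using m by (intro bexI[of _ "Suc j"]) auto
        next
          case False
          then have "\<exists>m\<in>{1..j}. good (Suc i) m" using that by (auto simp: le_Suc_eq)
          then have "?Q M1 (Suc i)" using 4(2) by blast
          then show ?thesis unfolding M2 using False by simp
        qed
        ultimately show "(\<forall>x\<in>{1..n}. Suc i < x \<longrightarrow> ?Q M2 x) \<and>
             ((\<exists>m\<in>{1..Suc j}. good (Suc i) m) \<longrightarrow> ?Q M2 (Suc i))" by blast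
      qed
    next
      case (5 R1 M1)
      have "?Q M1 (Suc i)" using 5(1) ex_good[of "Suc i"] 9(1) by auto
      then show ?case using 5(1) by (metis Suc_lessI)
    qed
  qed (use \<beta> n in auto)
  then show ?thesis by (simp add: good_def)
qed

end

definition algorithm :: "nat \<Rightarrow> nat \<Rightarrow> com" where
  "algorithm d p = assign_colours d p;; search d (p ^ d)"

definition algorithm_time :: "nat \<Rightarrow> nat \<Rightarrow> nat \<Rightarrow> nat" where
  "algorithm_time d p n = (n * ((p ^ d * match_time d + 1) + 3) + 3) +
     (1 + (1 + enum_time (n + 1) (try_time n d (p ^ d)) (p ^ d)))"

lemma (in machine) wp_algorithm:
  assumes \<beta>: "2 \<le> \<beta>" "p \<le> \<beta>" "d \<le> \<beta>" "p ^ d \<le> \<beta>" and matroid: "matroid {1..n} indep"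
    and wa: "\<forall>k\<in>{1..d}. \<forall>x\<in>{1..n}. w k x \<in> a ` {1..p}"
  shows "wp (algorithm d p) (algorithm_time d p n)
    (\<lambda>R' M'. optimal_base indep d w f (set_of_cells n (M' (d + 1))))
    (fst (input_state d p n a w)) (snd (input_state d p n a w))"
  unfolding algorithm_def algorithm_time_def
proof (rule wp_Seq, rule wp_mono[OF wp_assign_colours[where a = a and w = w] order.refl])
  fix R M
  assume col: "\<forall>x\<in>{1..n}. \<exists>m\<in>{1..p ^ d}. M (d + 2) (int x) = int m \<and>
      (\<forall>k\<in>{1..d}. w k x = a (tuple d p m k))"
    and R: "\<And>r. r \<notin> wreg (assign_colours d p) \<Longrightarrow> R r = fst (input_state d p n a w) r"
    and M: "\<And>m. m \<notin> wmem (assign_colours d p) \<Longrightarrow> M m = snd (input_state d p n a w) m"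
  have frR: "R r = fst (input_state d p n a w) r" if "r \<notin> {1, 2, 3, 4, 5, 6}" for r
    by (rule R) (use frame_assign_colours(1)[of d p] that in auto)
  have frM: "M m = snd (input_state d p n a w) m" if "m \<noteq> d + 2" for m
    by (rule M) (use frame_assign_colours(2)[of d p] that in auto)
  \<comment> \<open>The colouring is whatever the first phase left in memory; a colour names a tuple
    of indices, from which the weights are read off.\<close>
  interpret quota_search n d indep f \<beta> "p ^ d" w "\<lambda>x. M (d + 2) (int x)"
    "\<lambda>k y. a (tuple d p (nat y) k)"
  proof (rule quota_search.intro[OF matroid], unfold_locales)
    show "M (d + 2) (int x) \<in> {1..int (p ^ d)}" if "x \<in> {1..n}" for x
      using col that by fastforce
    show "w k x = a (tuple d p (nat (M (d + 2) (int x))) k)" if "k \<in> {1..d}" "x \<in> {1..n}" for k x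
      using col that by fastforce
  qed (use \<beta> in auto)
  have "input_ok R M" unfolding input_ok_def using frR[of 0] frM by (auto simp: input_state_def)
  \<comment> \<open>The zeros of the initial state already describe the empty set, its size and its
    zero profile, so the search needs no initialisation.\<close>
  moreover have "best {} R M"
    unfolding best_def using frR[of 10] frM[of "d + 1"] frM[of "d + 8"] indep_empty
    by (auto simp: input_state_def indicates_def vec_of_cells_def profile_def)
  ultimately show "wp (search d (p ^ d)) (1 + (1 + enum_time (n + 1) (try_time n d (p ^ d)) (p ^ d)))
      (\<lambda>R' M'. optimal_base indep d w f (set_of_cells n (M' (d + 1)))) R M"
    by (rule wp_search)
qed (use \<beta> wa in \<open>auto simp: input_state_def\<close>)

section \<open>Polynomial growth of the running time\<close>

definition poly_bounded :: "(nat \<Rightarrow> nat) \<Rightarrow> bool" where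
  "poly_bounded g \<longleftrightarrow> (\<exists>P :: nat poly. \<forall>n. g n \<le> poly P n)"

lemma poly_bounded_const: "poly_bounded (\<lambda>n. k)"
  unfolding poly_bounded_def by (rule exI[of _ "[:k:]"]) simp

lemma poly_bounded_id: "poly_bounded (\<lambda>n. n)"
  unfolding poly_bounded_def by (rule exI[of _ "[:0, 1:]"]) simp

lemma poly_bounded_add: "poly_bounded g \<Longrightarrow> poly_bounded h \<Longrightarrow> poly_bounded (\<lambda>n. g n + h n)"
  unfolding poly_bounded_def by (metis poly_add add_mono)

lemma poly_bounded_mult: "poly_bounded g \<Longrightarrow> poly_bounded h \<Longrightarrow> poly_bounded (\<lambda>n. g n * h n)"
  unfolding poly_bounded_def by (metis poly_mult mult_le_mono)

text \<open>The sum bounds the maximum; branching is the reason why \<open>poly_bounded\<close> asks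
  for an upper bound instead of equality with a polynomial.\<close>

lemma poly_bounded_max: "poly_bounded g \<Longrightarrow> poly_bounded h \<Longrightarrow> poly_bounded (\<lambda>n. max (g n) (h n))"
  using poly_bounded_add[of g h] unfolding poly_bounded_def by (meson max.bounded_iff le_add1 le_add2 order_trans)

text \<open>Each level of nesting multiplies by \<open>b n\<close>, so the bound is polynomial
  because the depth \<open>k\<close> does not vary with \<open>n\<close>.\<close>

lemma poly_bounded_enum_time:
  "poly_bounded b \<Longrightarrow> poly_bounded t \<Longrightarrow> poly_bounded (\<lambda>n. enum_time (b n) (t n) k)"
  by (induction k) (auto intro!: poly_bounded_add poly_bounded_mult poly_bounded_const
      simp del: add_Suc_right mult_Suc_right)

lemmas poly_bounded_intros = poly_bounded_const poly_bounded_id poly_bounded_add poly_bounded_mult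
  poly_bounded_max poly_bounded_enum_time

lemma poly_bounded_algorithm_time: "poly_bounded (algorithm_time d p)"
  unfolding algorithm_time_def try_time_def delete_time_def
    colour_test_time_def compare_time_def evaluate_time_def
    save_time_def match_time_def
  by (intro poly_bounded_intros)

text \<open>Granting \<open>n\<close> bits to the number \<open>n\<close> is crude but stays
  polynomial. Every weight is one of the values \<open>a i\<close> and inherits their length
  bound.\<close>

lemma bounded_input_state:
  assumes "p \<ge> 1" and wa: "\<forall>k\<in>{1..d}. \<forall>x\<in>{1..n}. w k x \<in> a ` {1..p}"
    and b: "n \<le> b" "(MAX i\<in>{1..p}. bin_length (a i)) \<le> b"
  shows "bounded_state b (fst (input_state d p n a w)) (snd (input_state d p n a w))"
proof -
  have a: "\<bar>a i\<bar> < 2 ^ b" if "i \<in> {1..p}" for i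
  proof (rule abs_less_of_bin_length)
    have "bin_length (a i) \<le> (MAX i\<in>{1..p}. bin_length (a i))" by (rule Max_ge) (use that in auto)
    then show "bin_length (a i) \<le> b" using b(2) by linarith
  qed
  have "n < 2 ^ b" using b(1) less_exp[of b] by linarith
  then have n: "int n < 2 ^ b" by (metis of_nat_less_iff of_nat_numeral of_nat_power)
  have w: "\<bar>w k (nat x)\<bar> < 2 ^ b" if "1 \<le> k" "k \<le> d" "1 \<le> x" "x \<le> int n" for k x
  proof -
    have "k \<in> {1..d}" "nat x \<in> {1..n}" using that by auto
    then have "w k (nat x) \<in> a ` {1..p}" using wa by blast
    then show ?thesis using a by auto
  qed
  have "\<bar>a (nat x)\<bar> < 2 ^ b" if "1 \<le> x" "x \<le> int p" for x
  proof -
    have "nat x \<in> {1..p}" using that by auto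
    then show ?thesis by (rule a)
  qed
  then show ?thesis
    using n w by (auto simp: bounded_state_def input_state_def)
qed

theorem theorem1p1:
  fixes d p :: nat
  assumes "d \<ge> 1" and "p \<ge> 1"
  shows "\<exists>(alg :: com) (q :: nat poly poly).
    \<forall>(n :: nat) (indep :: nat set \<Rightarrow> bool) (a :: nat \<Rightarrow> int)
      (w :: nat \<Rightarrow> nat \<Rightarrow> int) (f :: real list \<Rightarrow> real).
      matroid {1..n} indep \<and> (\<forall>i\<in>{1..d}. \<forall>j\<in>{1..n}. w i j \<in> a ` {1..p}) \<longrightarrow>
      (\<exists>t s. exec n d indep f alg (input_state d p n a w) t s \<and>
             t \<le> poly2 q n (MAX i\<in>{1..p}. bin_length (a i)) \<and>
             optimal_base indep d w f (output_set d n s))"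
proof -
  obtain P :: "nat poly" where P: "\<And>n. algorithm_time d p n \<le> poly P n"
    using poly_bounded_algorithm_time[of d p] unfolding poly_bounded_def by blast
  \<comment> \<open>Bounds all constants of the program: colour numbers up to \<open>p ^ d\<close>,
    tuple entries up to \<open>p\<close>, profile cells up to \<open>d\<close>, and 0, 1, 2.\<close>
  define \<beta> where "\<beta> = p ^ d + p + d + 2"
  define X :: "nat poly" where "X = [:0, 1:]"
  \<comment> \<open>The outer indeterminate stands for the length \<open>L\<close>, which enters
    linearly: the second coefficient is the factor of \<open>L\<close> in the cost bound. The
    constant \<open>\<beta> + 2\<close> joins the \<open>\<beta> + 1\<close> in \<open>b\<close> to
    the extra 1 in \<open>step_cost\<close>.\<close>
  define q :: "nat poly poly" where
    "q = [:P * (1 + (X + [:2 * d + 2:]) * (X + [:\<beta> + 2:] + P)), P * (X + [:2 * d + 2:]):]"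
  have q: "poly2 q n L = poly P n * (1 + (n + 2 * d + 2) * ((n + L + \<beta> + 1 + poly P n) + 1))" for n L
    by (simp add: poly2_def q_def X_def algebra_simps)
  show ?thesis
  proof (intro exI[of _ "algorithm d p"] exI[of _ q] allI impI, elim conjE)
    fix n indep and a :: "nat \<Rightarrow> int" and w :: "nat \<Rightarrow> nat \<Rightarrow> int" and f
    assume matroid: "matroid {1..n} indep" and wa: "\<forall>i\<in>{1..d}. \<forall>j\<in>{1..n}. w i j \<in> a ` {1..p}"
    define L where "L = (MAX i\<in>{1..p}. bin_length (a i))"
    \<comment> \<open>Large enough for the initial state, which needs \<open>n\<close> and
      \<open>L\<close>, and above \<open>\<beta>\<close>, as \<open>wp\<close> requires.\<close>
    define b where "b = n + L + \<beta> + 1"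
    interpret machine n d indep f \<beta> .
    let ?s = "input_state d p n a w"
    have "bounded_state b (fst ?s) (snd ?s)"
      by (rule bounded_input_state[OF assms(2) wa]) (auto simp: b_def L_def)
    moreover have "wp (algorithm d p) (poly P n)
      (\<lambda>R' M'. optimal_base indep d w f (set_of_cells n (M' (d + 1)))) (fst ?s) (snd ?s)"
      by (rule wp_le[OF wp_algorithm[OF _ _ _ _ matroid wa] P]) (auto simp: \<beta>_def)
    moreover have "\<beta> < b" by (simp add: b_def)
    ultimately obtain t R M where *: "exec n d indep f (algorithm d p) (fst ?s, snd ?s) t (R, M)"
      "t \<le> poly P n * step_cost (b + poly P n)" "optimal_base indep d w f (set_of_cells n (M (d + 1)))"
      using wpE by blast
    have "t \<le> poly2 q n L" using *(2) by (simp only: q step_cost_def b_def)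
    with * show "\<exists>t s. exec n d indep f (algorithm d p) ?s t s \<and>
        t \<le> poly2 q n (MAX i\<in>{1..p}. bin_length (a i)) \<and> optimal_base indep d w f (output_set d n s)"
      by (intro exI[of _ t] exI[of _ "(R, M)"]) (simp add: output_set_def L_def)
  qed
qed

end
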